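(* Let $\mathcal{F}$ be any function from reals to reals such that for any $\Pi^0_1$ tree $T\subseteq 2^{<\omega}$, if $T$ is infinite, then $\mathcal{F}(T)$ is an infinite path through $T$ that is uniformly computable from $0'$ together with a $\Pi^0_1$ index for $T$. Let $A\subseteq\omega$, and assume there is no $X$ in the range of $\mathcal{F}$ such that $\{n:X(n)=A(n)\}$ is density-1. Then $A$ is density-1-bounding in the generic degrees.
   Context: A real is a subset of $\omega$, identified with its characteristic function $\omega\to\{0,1\}$; trees $T\subseteq2^{<\omega}$ are identified with reals via a standard coding of $2^{<\omega}$. A $\Pi^0_1$ tree is a subset of $2^{<\omega}$ closed under initial segments that is $\Pi^0_1$ as a set of strings. "Uniformly computable from $0'$ together with a $\Pi^0_1$ index" means that there is a single Turing functional that, given oracle $0'$ and any $\Pi^0_1$ index of an infinite $\Pi^0_1$ tree $T$, computes $\mathcal{F}(T)$. A real $X$ is density-1 if $\lim_{n\to\infty}|X\cap n|/n=1$, where $n=\{0,\dots,n-1\}$. A (time-dependent) partial oracle $(A)$ for a real $A$ is a set of triples $\langle n,x,l\rangle$ with $n,l\in\omega$, $x\in\{0,1\}$, such that $\langle n,x,l\rangle\in(A)$ implies $A(n)=x$, and for every $n,x$ there is at most one $l$ with $\langle n,x,l\rangle\in(A)$. Its domain is the set of $n$ for which some $\langle n,x,l\rangle\in(A)$ exists. A Turing functional $\phi$ uses $(A)$ as an ordinary oracle for this set of triples. A generic oracle for $A$ is a partial oracle for $A$ with density-1 domain. A generic computation of $B$ is a partial function $\psi$ computed by some machine (possibly with an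 oracle), with density-1 domain, such that $\psi(n)=B(n)$ whenever $\psi(n)\downarrow$. $B$ is generically computable if it has a generic computation without oracle. $B\leq_{\mathrm{g}}A$ if there is a single Turing functional $\phi$ such that for every generic oracle $(A)$ for $A$, $\phi^{(A)}$ is a generic computation of $B$. The generic degrees are the equivalence classes induced by $\leq_{\mathrm{g}}$; the zero degree consists of the generically computable reals. A real $A$ is density-1-bounding (in the generic degrees) if there is a density-1 real $B$ that is not generically computable with $B\leq_{\mathrm{g}}A$. *)

theory Defs
  imports "HOL-Analysis.Analysis" "HOL-Library.Nat_Bijection" "HOL-Library.Sublist"
begin

definition chi :: "nat set \<Rightarrow> nat \<Rightarrow> nat" where
  "chi X n = (if n \<in> X then 1 else 0)"

definition density1 :: "nat set \<Rightarrow> bool" where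
  "density1 X \<longleftrightarrow> (\<lambda>n. real (card (X \<inter> {..<n})) / real n) \<longlonglongrightarrow> 1"

text \<open>
  Unary partial recursive functions relative to an oracle set; several arguments are
  passed as one number via the Cantor pairing \<^const>\<open>prod_encode\<close>. A Turing functional
  is a program, and \<open>run X p\<close> is the partial function that it computes with oracle \<open>X\<close>.
  Computability without an oracle is computability with the empty oracle.
\<close>

datatype prog =
    Zero
  | Succ
  | Fst
  | Snd
  | Query
  | Fork prog prog
  | Comp prog prog
  | PrimRec prog prog
  | Mu prog

primrec run :: "nat set \<Rightarrow> prog \<Rightarrow> nat \<Rightarrow> nat option" where
  "run X Zero = (\<lambda>x. Some 0)"
| "run X Succ = (\<lambda>x. Some (Suc x))"
| "run X Fst = (\<lambda>x. Some (fst (prod_decode x)))"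
| "run X Snd = (\<lambda>x. Some (snd (prod_decode x)))"
| "run X Query = (\<lambda>x. Some (chi X x))"
| "run X (Fork p q) =
     (\<lambda>x. Option.bind (run X p x) (\<lambda>a. Option.bind (run X q x) (\<lambda>b. Some (prod_encode (a, b)))))"
| "run X (Comp p q) = (\<lambda>x. Option.bind (run X q x) (run X p))"
| "run X (PrimRec p q) =
     (\<lambda>x. case prod_decode x of (a, n) \<Rightarrow>
        rec_nat (run X p a)
          (\<lambda>k r. Option.bind r (\<lambda>v. run X q (prod_encode (a, prod_encode (k, v))))) n)"
| "run X (Mu p) =
     (\<lambda>x. if \<exists>y. run X p (prod_encode (x, y)) = Some 0 \<and>
               (\<forall>z<y. run X p (prod_encode (x, z)) \<noteq> None)
          then Some (LEAST y. run X p (prod_encode (x, y)) = Some 0)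
          else None)"

primrec index :: "prog \<Rightarrow> nat" where
  "index Zero = 0"
| "index Succ = 1"
| "index Fst = 2"
| "index Snd = 3"
| "index Query = 4"
| "index (Fork p q) = 5 + 4 * prod_encode (index p, index q)"
| "index (Comp p q) = 6 + 4 * prod_encode (index p, index q)"
| "index (PrimRec p q) = 7 + 4 * prod_encode (index p, index q)"
| "index (Mu p) = 8 + 4 * index p"

lemma inj_index: "inj index"
proof (rule injI)
  fix p q show "index p = index q \<Longrightarrow> p = q"
  proof (induction p arbitrary: q)
    case Zero then show ?case by (cases q) auto
  next
    case Succ then show ?case by (cases q) auto
  next
    case Fst then show ?case by (cases q) auto
  next
    case Snd then show ?case by (cases q) auto
  next
    case Query then show ?case by (cases q) auto
  next
    case (Fork p1 p2) then show ?case by (cases q) (simp; presburger?)+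
  next
    case (Comp p1 p2) then show ?case by (cases q) (simp; presburger?)+
  next
    case (PrimRec p1 p2) then show ?case by (cases q) (simp; presburger?)+
  next
    case (Mu p) then show ?case by (cases q) (simp; presburger?)+
  qed
qed

lemma surj_index: "\<exists>p. index p = e"
proof (induction e rule: less_induct)
  case (less e)
  show ?case
  proof (cases "e < 5")
    case True
    then consider "e = 0" | "e = 1" | "e = 2" | "e = 3" | "e = 4" by linarith
    then show ?thesis by cases (metis index.simps)+
  next
    case False
    define m where "m = (e - 5) div 4"
    define a where "a = fst (prod_decode m)"
    define b where "b = snd (prod_decode m)"
    have m: "prod_encode (a, b) = m" by (simp add: a_def b_def)
    have "m < e" using False by (auto simp: m_def)
    moreover have "a \<le> m" "b \<le> m" using le_prod_encode_1 le_prod_encode_2 m by metis+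
    ultimately obtain p q r where pqr: "index p = a" "index q = b" "index r = m"
      using less by (meson le_less_trans)
    have "e = 5 + 4 * m \<or> e = 6 + 4 * m \<or> e = 7 + 4 * m \<or> e = 8 + 4 * m"
      using False unfolding m_def by presburger
    then show ?thesis using pqr m by (metis index.simps(6-9))
  qed
qed

lemma bij_index: "bij index"
  using inj_index surj_index by (metis bijI surjI)

(* 0', as the diagonal halting set. *)
definition zero_jump :: "nat set" where
  "zero_jump = {index p | p. run {} p (index p) \<noteq> None}"

(* The string s has code m where m + 1 has binary digits s, least significant first,
   followed by a leading 1. *)
primrec str_code :: "bool list \<Rightarrow> nat" where
  "str_code [] = 0"
| "str_code (b # s) = 2 * str_code s + (if b then 2 else 1)"

lemma inj_str_code: "inj str_code"
proof (rule injI)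
  fix s t show "str_code s = str_code t \<Longrightarrow> s = t"
  proof (induction s arbitrary: t)
    case Nil then show ?case by (cases t) (auto split: if_splits)
  next
    case (Cons b s)
    then obtain c t' where t: "t = c # t'" by (cases t) (auto split: if_splits)
    then have "b = c \<and> str_code s = str_code t'"
      using Cons.prems by (simp split: if_splits; presburger)
    then show ?case using Cons.IH t by simp
  qed
qed

lemma surj_str_code: "\<exists>s. str_code s = n"
proof (induction n rule: less_induct)
  case (less n)
  show ?case
  proof (cases "n = 0")
    case True then show ?thesis by (metis str_code.simps(1))
  next
    case False
    then obtain s where s: "str_code s = (n - 1) div 2" using less[of "(n - 1) div 2"] by fastforce
    have "n = 2 * ((n - 1) div 2) + (if even n then 2 else 1)"
      using False by presburger
    then show ?thesis using s by (metis str_code.simps(2))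
  qed
qed

lemma bij_str_code: "bij str_code"
  using inj_str_code surj_str_code by (metis bijI surjI)

definition tree_real :: "bool list set \<Rightarrow> nat set" where
  "tree_real T = str_code ` T"

definition is_tree :: "bool list set \<Rightarrow> bool" where
  "is_tree T \<longleftrightarrow> (\<forall>s\<in>T. \<forall>t. prefix t s \<longrightarrow> t \<in> T)"

(* e is an index of a program whose domain is the set of codes of the strings outside T. *)
definition pi01_index :: "nat \<Rightarrow> bool list set \<Rightarrow> bool" where
  "pi01_index e T \<longleftrightarrow> (\<exists>p. index p = e \<and> dom (run {} p) = tree_real (- T))"

definition pi01_tree :: "bool list set \<Rightarrow> bool" where
  "pi01_tree T \<longleftrightarrow> is_tree T \<and> (\<exists>e. pi01_index e T)"

definition path_through :: "nat set \<Rightarrow> bool list set \<Rightarrow> bool" where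
  "path_through X T \<longleftrightarrow> (\<forall>n. map (\<lambda>i. i \<in> X) [0..<n] \<in> T)"

definition partial_oracle :: "(nat \<times> nat \<times> nat) set \<Rightarrow> nat set \<Rightarrow> bool" where
  "partial_oracle P A \<longleftrightarrow>
     (\<forall>n x l. (n, x, l) \<in> P \<longrightarrow> chi A n = x) \<and>
     (\<forall>n x l l'. (n, x, l) \<in> P \<longrightarrow> (n, x, l') \<in> P \<longrightarrow> l = l')"

definition oracle_dom :: "(nat \<times> nat \<times> nat) set \<Rightarrow> nat set" where
  "oracle_dom P = {n. \<exists>x l. (n, x, l) \<in> P}"

definition generic_oracle :: "(nat \<times> nat \<times> nat) set \<Rightarrow> nat set \<Rightarrow> bool" where
  "generic_oracle P A \<longleftrightarrow> partial_oracle P A \<and> density1 (oracle_dom P)"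

definition triples_real :: "(nat \<times> nat \<times> nat) set \<Rightarrow> nat set" where
  "triples_real P = {prod_encode (n, prod_encode (x, l)) | n x l. (n, x, l) \<in> P}"

definition generic_computation :: "nat set \<Rightarrow> prog \<Rightarrow> nat set \<Rightarrow> bool" where
  "generic_computation X p B \<longleftrightarrow>
     density1 (dom (run X p)) \<and> (\<forall>n y. run X p n = Some y \<longrightarrow> y = chi B n)"

definition generically_computable :: "nat set \<Rightarrow> bool" where
  "generically_computable B \<longleftrightarrow> (\<exists>p. generic_computation {} p B)"

definition generic_reducible :: "nat set \<Rightarrow> nat set \<Rightarrow> bool" (infix "\<le>\<^sub>g" 50) where
  "B \<le>\<^sub>g A \<longleftrightarrow>
     (\<exists>p. \<forall>P. generic_oracle P A \<longrightarrow> generic_computation (triples_real P) p B)"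

definition density1_bounding :: "nat set \<Rightarrow> bool" where
  "density1_bounding A \<longleftrightarrow>
     (\<exists>B. density1 B \<and> \<not> generically_computable B \<and> B \<le>\<^sub>g A)"

end

theory Submission
  imports Defs
begin

text \<open>
  Let \<open>W\<^sub>e\<close> be the set on which the \<open>e\<close>-th program returns 1, and split the positive numbers into
  blocks \<open>(e, t)\<close>, where the column \<open>e\<close> has positive density and the block \<open>(e, t)\<close> lies between
  \<open>2 ^ t\<close> and \<open>2 ^ (t + 1)\<close>. By the recursion theorem there is a tree \<open>T\<^sub>e\<close> that removes a string as
  soon as \<open>W\<^sub>e\<close> meets a block \<open>(e, t)\<close> such that the string extends the stage-\<open>t\<close> guess at the path
  \<open>X\<^sub>e = F(T\<^sub>e)\<close>. The set \<open>B\<close> receives the block \<open>(e, t)\<close> when \<open>A\<close> is seen to differ from this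
  guess, or when \<open>T\<^sub>e\<close> has been seen to be finite by stage \<open>t\<close>.

  If \<open>T\<^sub>e\<close> is infinite, then \<open>A\<close> differs from \<open>X\<^sub>e\<close> somewhere on the domain of any generic oracle, and
  the guesses converge to \<open>X\<^sub>e\<close>; so every generic oracle enumerates almost all of each column. If
  \<open>W\<^sub>e\<close> had density 1, it would meet almost all blocks of column \<open>e\<close>, in particular one at a stage
  whose guess is correct, and then \<open>X\<^sub>e\<close> would not be a path; so \<open>T\<^sub>e\<close> is finite. But then \<open>A\<close> was
  removed because of some block that meets \<open>W\<^sub>e\<close>, and the first such block is never put into \<open>B\<close>.
\<close>

section \<open>Computable functions and decidable relations\<close>

abbreviation pair :: "nat \<Rightarrow> nat \<Rightarrow> nat" where
  "pair a b \<equiv> prod_encode (a, b)"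

abbreviation pfst :: "nat \<Rightarrow> nat" where
  "pfst z \<equiv> fst (prod_decode z)"

abbreviation psnd :: "nat \<Rightarrow> nat" where
  "psnd z \<equiv> snd (prod_decode z)"

text \<open>A single program has to work for all oracles, so it can serve both with the empty oracle
  and as a component of a functional that queries its oracle.\<close>

definition computable :: "(nat \<Rightarrow> nat) \<Rightarrow> bool" where
  "computable f \<longleftrightarrow> (\<exists>p. \<forall>X x. run X p x = Some (f x))"

definition decidable :: "(nat \<Rightarrow> bool) \<Rightarrow> bool" where
  "decidable P \<longleftrightarrow> computable (\<lambda>x. of_bool (P x))"

named_theorems computable_intros

lemma computableI: "(\<And>X x. run X p x = Some (f x)) \<Longrightarrow> computable f"
  unfolding computable_def by blast

lemma computableD: "computable f \<Longrightarrow> \<exists>p. \<forall>X. run X p = (\<lambda>x. Some (f x))"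
  unfolding computable_def by (simp add: fun_eq_iff)

lemma computable_comp:
  assumes "computable f" "computable g"
  shows "computable (\<lambda>x. f (g x))"
proof -
  obtain p where p: "\<And>X. run X p = (\<lambda>x. Some (f x))" using computableD[OF assms(1)] by blast
  obtain q where q: "\<And>X. run X q = (\<lambda>x. Some (g x))" using computableD[OF assms(2)] by blast
  show ?thesis by (rule computableI[of "Comp p q"]) (simp add: p q)
qed

lemma computable_id[computable_intros]: "computable (\<lambda>x. x)"
  by (rule computableI[of "Fork Fst Snd"]) simp

lemma computable_pair[computable_intros]:
  assumes "computable f" "computable g"
  shows "computable (\<lambda>x. pair (f x) (g x))"
proof -
  obtain p where p: "\<And>X. run X p = (\<lambda>x. Some (f x))" using computableD[OF assms(1)] by blast
  obtain q where q: "\<And>X. run X q = (\<lambda>x. Some (g x))" using computableD[OF assms(2)] by blast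
  show ?thesis by (rule computableI[of "Fork p q"]) (simp add: p q)
qed

lemma computable_Suc[computable_intros]: "computable f \<Longrightarrow> computable (\<lambda>x. Suc (f x))"
  by (rule computable_comp[of Suc]) (rule computableI[of Succ], simp)

lemma computable_pfst[computable_intros]: "computable f \<Longrightarrow> computable (\<lambda>x. pfst (f x))"
  by (rule computable_comp[of pfst]) (rule computableI[of Fst], simp)

lemma computable_psnd[computable_intros]: "computable f \<Longrightarrow> computable (\<lambda>x. psnd (f x))"
  by (rule computable_comp[of psnd]) (rule computableI[of Snd], simp)

lemma computable_const[computable_intros]: "computable (\<lambda>x. c)"
proof (induction c)
  case 0 show ?case by (rule computableI[of Zero]) simp
next
  case (Suc c) then show ?case by (rule computable_Suc)
qed

lemma computable_comp2:
  assumes "computable (\<lambda>z. h (pfst z) (psnd z))" "computable f" "computable g"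
  shows "computable (\<lambda>x. h (f x) (g x))"
  using computable_comp[OF assms(1) computable_pair[OF assms(2,3)]] by simp

lemma computable_comp3:
  assumes "computable (\<lambda>z. h (pfst z) (pfst (psnd z)) (psnd (psnd z)))"
    and "computable f" "computable g" "computable k"
  shows "computable (\<lambda>x. h (f x) (g x) (k x))"
  using computable_comp[OF assms(1) computable_pair[OF assms(2) computable_pair[OF assms(3,4)]]]
  by simp

lemma computable_rec_nat[computable_intros]:
  assumes "computable b" "computable (\<lambda>z. g (pfst z) (pfst (psnd z)) (psnd (psnd z)))"
    and "computable n"
  shows "computable (\<lambda>x. rec_nat (b x) (g x) (n x))"
proof -
  obtain p where p: "\<And>X. run X p = (\<lambda>x. Some (b x))" using computableD[OF assms(1)] by blast
  obtain q where q: "\<And>X. run X q = (\<lambda>z. Some (g (pfst z) (pfst (psnd z)) (psnd (psnd z))))"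
    using computableD[OF assms(2)] by blast
  have *: "rec_nat (Some (b x)) (\<lambda>k r. Option.bind r (\<lambda>v. Some (g x k v))) m
      = Some (rec_nat (b x) (g x) m)" for x m
    by (induction m) auto
  have "computable (\<lambda>z. rec_nat (b (pfst z)) (g (pfst z)) (psnd z))"
    by (rule computableI[of "PrimRec p q"]) (simp add: p q * split: prod.split)
  from computable_comp2[OF this computable_id assms(3)] show ?thesis .
qed

lemma computable_add[computable_intros]:
  assumes "computable f" "computable g"
  shows "computable (\<lambda>x. f x + g x)"
proof -
  have "rec_nat a (\<lambda>k r. Suc r) b = a + b" for a b by (induction b) auto
  moreover have "computable (\<lambda>x. rec_nat (f x) (\<lambda>k r. Suc r) (g x))"
    by (intro computable_intros assms)
  ultimately show ?thesis by simp
qed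

lemma computable_mult[computable_intros]:
  assumes "computable f" "computable g"
  shows "computable (\<lambda>x. f x * g x)"
proof -
  have "rec_nat 0 (\<lambda>k r. r + a) b = a * b" for a b :: nat by (induction b) auto
  moreover have "computable (\<lambda>x. rec_nat 0 (\<lambda>k r. r + f x) (g x))"
    by (intro computable_intros computable_comp[OF assms(1)] assms)
  ultimately show ?thesis by simp
qed

lemma computable_power[computable_intros]:
  assumes "computable f" "computable g"
  shows "computable (\<lambda>x. f x ^ g x)"
proof -
  have "rec_nat 1 (\<lambda>k r. r * a) b = a ^ b" for a b :: nat by (induction b) auto
  moreover have "computable (\<lambda>x. rec_nat 1 (\<lambda>k r. r * f x) (g x))"
    by (intro computable_intros computable_comp[OF assms(1)] assms)
  ultimately show ?thesis by simp
qed

lemma computable_diff[computable_intros]: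
  assumes "computable f" "computable g"
  shows "computable (\<lambda>x. f x - g x)"
proof -
  have pred: "rec_nat 0 (\<lambda>k r. k) a = a - 1" for a :: nat by (cases a) auto
  have *: "rec_nat a (\<lambda>k r. rec_nat 0 (\<lambda>k r. k) r) b = a - b" for a b :: nat
    unfolding pred by (induction b) auto
  have "computable (\<lambda>x. rec_nat (f x) (\<lambda>k r. rec_nat 0 (\<lambda>k r. k) r) (g x))"
    by (intro computable_intros assms)
  then show ?thesis unfolding * .
qed

lemma decidable_less[computable_intros]:
  assumes "computable f" "computable g"
  shows "decidable (\<lambda>x. f x < g x)"
proof -
  have "of_bool (a < b) = 1 - (1 - (b - a))" for a b :: nat by auto
  moreover have "computable (\<lambda>x. 1 - (1 - (g x - f x)))" by (intro computable_intros assms)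
  ultimately show ?thesis unfolding decidable_def by simp
qed

lemma decidable_not[computable_intros]:
  assumes "decidable P"
  shows "decidable (\<lambda>x. \<not> P x)"
proof -
  have "of_bool (\<not> b) = (1 - of_bool b :: nat)" for b by simp
  then show ?thesis
    unfolding decidable_def by (simp only:) (intro computable_intros assms[unfolded decidable_def])
qed

lemma decidable_conj[computable_intros]:
  assumes "decidable P" "decidable Q"
  shows "decidable (\<lambda>x. P x \<and> Q x)"
  unfolding decidable_def of_bool_conj
  by (intro computable_intros assms[unfolded decidable_def])

lemma decidable_disj[computable_intros]:
  assumes "decidable P" "decidable Q"
  shows "decidable (\<lambda>x. P x \<or> Q x)"
proof -
  have "decidable (\<lambda>x. \<not> (\<not> P x \<and> \<not> Q x))" by (intro computable_intros assms)
  then show ?thesis by simp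
qed

lemma decidable_imp[computable_intros]:
  assumes "decidable P" "decidable Q"
  shows "decidable (\<lambda>x. P x \<longrightarrow> Q x)"
  unfolding imp_conv_disj by (intro computable_intros assms)

lemma decidable_le[computable_intros]:
  assumes "computable f" "computable g"
  shows "decidable (\<lambda>x. f x \<le> g x)"
  unfolding not_less[symmetric] by (intro computable_intros assms)

lemma decidable_eq[computable_intros]:
  assumes "computable f" "computable g"
  shows "decidable (\<lambda>x. f x = g x)"
  unfolding eq_iff by (intro computable_intros assms)

lemma computable_of_bool[computable_intros]: "decidable P \<Longrightarrow> computable (\<lambda>x. of_bool (P x))"
  by (simp add: decidable_def)

lemma computable_if[computable_intros]:
  assumes "decidable P" "computable f" "computable g"
  shows "computable (\<lambda>x. if P x then f x else g x)"
proof -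
  have "computable (\<lambda>x. of_bool (P x) * f x + of_bool (\<not> P x) * g x)"
    by (intro computable_intros assms)
  moreover have "of_bool (P x) * f x + of_bool (\<not> P x) * g x = (if P x then f x else g x)" for x
    by simp
  ultimately show ?thesis by simp
qed

lemma decidable_comp: "decidable P \<Longrightarrow> computable f \<Longrightarrow> decidable (\<lambda>x. P (f x))"
  unfolding decidable_def by (rule computable_comp)

lemma decidable_comp2:
  assumes "decidable (\<lambda>z. P (pfst z) (psnd z))" "computable f" "computable g"
  shows "decidable (\<lambda>x. P (f x) (g x))"
  using decidable_comp[OF assms(1) computable_pair[OF assms(2,3)]] by simp

lemma decidable_comp4:
  assumes "decidable (\<lambda>z. P (pfst z) (pfst (psnd z)) (pfst (psnd (psnd z))) (psnd (psnd (psnd z))))"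
    and "computable f" "computable g" "computable h" "computable k"
  shows "decidable (\<lambda>x. P (f x) (g x) (h x) (k x))"
  using decidable_comp[OF assms(1)
      computable_pair[OF assms(2) computable_pair[OF assms(3) computable_pair[OF assms(4,5)]]]]
  by simp

section \<open>Bounded quantifiers, search, and coded finite sets\<close>

lemma decidable_bex[computable_intros]:
  assumes "decidable (\<lambda>z. P (pfst z) (psnd z))" "computable b"
  shows "decidable (\<lambda>x. \<exists>k<b x. P x k)"
proof -
  have *: "rec_nat 0 (\<lambda>k r. if P x k then 1 else r) m = of_bool (\<exists>k<m. P x k)" for x m
    by (induction m) (auto simp: less_Suc_eq)
  have "computable (\<lambda>x. rec_nat 0 (\<lambda>k r. if P x k then 1 else r) (b x))"
    by (intro computable_intros assms decidable_comp2[OF assms(1)])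
  then show ?thesis unfolding * decidable_def .
qed

lemma decidable_ball[computable_intros]:
  assumes "decidable (\<lambda>z. P (pfst z) (psnd z))" "computable b"
  shows "decidable (\<lambda>x. \<forall>k<b x. P x k)"
proof -
  have "decidable (\<lambda>x. \<not> (\<exists>k<b x. \<not> P x k))" by (intro computable_intros assms)
  then show ?thesis by simp
qed

text \<open>The test program converges everywhere, so unbounded search finds the least witness,
  which exists by \<open>ex\<close>.\<close>

lemma computable_Least:
  assumes "decidable (\<lambda>z. P (pfst z) (psnd z))" and ex: "\<And>x. \<exists>k. P x k"
  shows "computable (\<lambda>x. LEAST k. P x k)"
proof -
  have "computable (\<lambda>z. of_bool (\<not> P (pfst z) (psnd z)))"
    by (intro computable_intros assms)
  from computableD[OF this] obtain p where p: "\<And>X. run X p = (\<lambda>z. Some (of_bool (\<not> P (pfst z) (psnd z))))"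
    by blast
  show ?thesis by (rule computableI[of "Mu p"]) (use ex in \<open>simp add: p\<close>)
qed

lemma decidable_odd[computable_intros]:
  assumes "computable f"
  shows "decidable (\<lambda>x. odd (f x))"
proof -
  have *: "rec_nat 0 (\<lambda>k r. 1 - r :: nat) m = of_bool (odd m)" for m :: nat
    by (induction m) auto
  have "computable (\<lambda>x. rec_nat 0 (\<lambda>k r. 1 - r :: nat) (f x))" by (intro computable_intros assms)
  then show ?thesis unfolding * decidable_def .
qed

lemma computable_div2[computable_intros]:
  assumes "computable f"
  shows "computable (\<lambda>x. f x div 2)"
proof -
  have *: "rec_nat 0 (\<lambda>k r. r + of_bool (odd k) :: nat) m = m div 2" for m :: nat
  proof (induction m)
    case (Suc m) then show ?case by (cases "odd m") simp_all
  qed simp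
  have "computable (\<lambda>x. rec_nat 0 (\<lambda>k r. r + of_bool (odd k) :: nat) (f x))"
    by (intro computable_intros assms)
  then show ?thesis unfolding * .
qed

lemma decidable_set_decode[computable_intros]:
  assumes "computable f" "computable g"
  shows "decidable (\<lambda>x. f x \<in> set_decode (g x))"
proof -
  have *: "rec_nat m (\<lambda>k r. r div 2) n = m div 2 ^ n" for m n :: nat
    by (induction n) (simp_all add: div_mult2_eq[symmetric] mult.commute)
  have "decidable (\<lambda>x. odd (rec_nat (g x) (\<lambda>k r. r div 2) (f x)))"
    by (intro computable_intros assms)
  then show ?thesis unfolding * set_decode_def by simp
qed

lemma computable_set_encode[computable_intros]:
  assumes "decidable (\<lambda>z. P (pfst z) (psnd z))" "computable b"
  shows "computable (\<lambda>x. set_encode {k. k < b x \<and> P x k})"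
proof -
  have *: "rec_nat 0 (\<lambda>k r. if P x k then r + 2 ^ k else r) m = set_encode {k. k < m \<and> P x k}" for x m
  proof (induction m)
    case (Suc m)
    have "{k. k < Suc m \<and> P x k} = (if P x m then insert m {k. k < m \<and> P x k} else {k. k < m \<and> P x k})"
      by (auto simp: less_Suc_eq)
    then show ?case using Suc by simp
  qed simp
  have "computable (\<lambda>x. rec_nat 0 (\<lambda>k r. if P x k then r + 2 ^ k else r) (b x))"
    by (intro computable_intros assms decidable_comp2[OF assms(1)])
  then show ?thesis unfolding * .
qed

section \<open>A stage-wise universal evaluator\<close>

abbreviation triple :: "nat \<Rightarrow> nat \<Rightarrow> nat \<Rightarrow> nat" where
  "triple e x y \<equiv> pair e (pair x y)"

text \<open>\<open>D\<close> codes a finite set that answers the oracle queries below \<open>u\<close>, larger queries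
  diverge; \<open>R e x y\<close> lists the computations found so far, and \<open>s\<close> bounds the search.\<close>

definition step :: "nat \<Rightarrow> nat \<Rightarrow> nat \<Rightarrow> (nat \<Rightarrow> nat \<Rightarrow> nat \<Rightarrow> bool) \<Rightarrow> nat \<Rightarrow> nat \<Rightarrow> nat \<Rightarrow> bool"
  where
  "step D u s R e x y \<longleftrightarrow>
     e = 0 \<and> y = 0 \<or> e = 1 \<and> y = Suc x \<or> e = 2 \<and> y = pfst x \<or> e = 3 \<and> y = psnd x \<or>
     e = 4 \<and> x < u \<and> y = of_bool (x \<in> set_decode D) \<or>
     (\<exists>a<e. \<exists>b<e.
        e = 5 + 4 * pair a b \<and> R a x (pfst y) \<and> R b x (psnd y) \<or>
        e = 6 + 4 * pair a b \<and> (\<exists>v<s. R b x v \<and> R a v y) \<or>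
        e = 7 + 4 * pair a b \<and>
          (psnd x = 0 \<and> R a (pfst x) y \<or>
           (\<exists>k<psnd x. psnd x = Suc k \<and>
              (\<exists>v<s. R e (pair (pfst x) k) v \<and> R b (triple (pfst x) k v) y)))) \<or>
     (\<exists>a<e. e = 8 + 4 * a \<and> R a (pair x y) 0 \<and> (\<forall>z<y. \<exists>v<s. 0 < v \<and> R a (pair x z) v))"

text \<open>Every stage is the code of a finite set of triples (index, input, output). The cap
  \<open>k < s\<close> keeps it finite and never drops a computation already found, as the cap grows
  with the stage.\<close>

definition stage :: "nat \<Rightarrow> nat \<Rightarrow> nat \<Rightarrow> nat" where
  "stage D u = rec_nat 0 (\<lambda>s c. set_encode {k. k < s \<and> (k \<in> set_decode c \<or>
     step D u s (\<lambda>e x y. triple e x y \<in> set_decode c) (pfst k) (pfst (psnd k)) (psnd (psnd k)))})"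

definition computed :: "nat \<Rightarrow> nat \<Rightarrow> nat \<Rightarrow> nat \<Rightarrow> nat \<Rightarrow> nat \<Rightarrow> bool" where
  "computed D u s e x y \<longleftrightarrow> triple e x y \<in> set_decode (stage D u s)"

lemma computed_0: "\<not> computed D u 0 e x y"
  by (simp add: computed_def stage_def)

lemma computed_Suc:
  "computed D u (Suc s) e x y \<longleftrightarrow>
     triple e x y < s \<and> (computed D u s e x y \<or> step D u s (computed D u s) e x y)"
  unfolding computed_def[abs_def] by (subst (1) stage_def) (simp add: stage_def set_encode_inverse)

lemma computed_less: "computed D u s e x y \<Longrightarrow> triple e x y < s"
  by (cases s) (auto simp: computed_0 computed_Suc)

lemma computable_stage: "computable (\<lambda>z. stage (pfst z) (pfst (psnd z)) (psnd (psnd z)))"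
  unfolding stage_def step_def by (intro computable_intros)

lemma decidable_computed[computable_intros]:
  assumes "computable D" "computable u" "computable s" "computable e" "computable x" "computable y"
  shows "decidable (\<lambda>z. computed (D z) (u z) (s z) (e z) (x z) (y z))"
  unfolding computed_def by (intro computable_intros computable_comp3[OF computable_stage] assms)

lemma pair_index_less:
  "a < n + 4 * pair a b \<and> b < n + 4 * pair a b" if "n > 0" for n :: nat
  using le_prod_encode_1[of a b] le_prod_encode_2[of b a] that by linarith+

text \<open>The four shapes have different residues modulo 4.\<close>

lemma index_shape_ne:
  fixes a b :: nat
  shows "5 + 4 * a \<noteq> 6 + 4 * b" "5 + 4 * a \<noteq> 7 + 4 * b" "5 + 4 * a \<noteq> 8 + 4 * b"
    "6 + 4 * a \<noteq> 7 + 4 * b" "6 + 4 * a \<noteq> 8 + 4 * b" "7 + 4 * a \<noteq> 8 + 4 * b"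
  by presburger+

text \<open>On the index of a program only one clause of \<open>step\<close> can apply. The bounds
  on \<open>a\<close>, \<open>b\<close> and \<open>k\<close>, which keep \<open>step\<close>
  decidable, exclude nothing because subprograms have smaller indices.\<close>

lemma step_index:
  "step D u s R (index Zero) x y \<longleftrightarrow> y = 0"
  "step D u s R (index Succ) x y \<longleftrightarrow> y = Suc x"
  "step D u s R (index Fst) x y \<longleftrightarrow> y = pfst x"
  "step D u s R (index Snd) x y \<longleftrightarrow> y = psnd x"
  "step D u s R (index Query) x y \<longleftrightarrow> x < u \<and> y = of_bool (x \<in> set_decode D)"
  "step D u s R (index (Fork p q)) x y \<longleftrightarrow> R (index p) x (pfst y) \<and> R (index q) x (psnd y)"
  "step D u s R (index (Comp p q)) x y \<longleftrightarrow> (\<exists>v<s. R (index q) x v \<and> R (index p) v y)"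
  "step D u s R (index (PrimRec p q)) x y \<longleftrightarrow>
     psnd x = 0 \<and> R (index p) (pfst x) y \<or>
     (\<exists>k. psnd x = Suc k \<and> (\<exists>v<s. R (index (PrimRec p q)) (pair (pfst x) k) v \<and>
        R (index q) (triple (pfst x) k v) y))"
  "step D u s R (index (Mu p)) x y \<longleftrightarrow>
     R (index p) (pair x y) 0 \<and> (\<forall>z<y. \<exists>v<s. 0 < v \<and> R (index p) (pair x z) v)"
proof -
  note * = step_def index_shape_ne index_shape_ne[symmetric] prod_encode_eq
  show "step D u s R (index Zero) x y \<longleftrightarrow> y = 0" by (simp add: *)
  show "step D u s R (index Succ) x y \<longleftrightarrow> y = Suc x" by (simp add: *)
  show "step D u s R (index Fst) x y \<longleftrightarrow> y = pfst x" by (simp add: *)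
  show "step D u s R (index Snd) x y \<longleftrightarrow> y = psnd x" by (simp add: *)
  show "step D u s R (index Query) x y \<longleftrightarrow> x < u \<and> y = of_bool (x \<in> set_decode D)"
    by (simp add: *)
  show "step D u s R (index (Fork p q)) x y \<longleftrightarrow> R (index p) x (pfst y) \<and> R (index q) x (psnd y)"
    using pair_index_less[of 5 "index p" "index q"] by (auto simp: *)
  show "step D u s R (index (Comp p q)) x y \<longleftrightarrow> (\<exists>v<s. R (index q) x v \<and> R (index p) v y)"
    using pair_index_less[of 6 "index p" "index q"] by (auto simp: *)
  show "step D u s R (index (PrimRec p q)) x y \<longleftrightarrow>
     psnd x = 0 \<and> R (index p) (pfst x) y \<or>
     (\<exists>k. psnd x = Suc k \<and> (\<exists>v<s. R (index (PrimRec p q)) (pair (pfst x) k) v \<and>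
        R (index q) (triple (pfst x) k v) y))"
    using pair_index_less[of 7 "index p" "index q"] by (auto simp: *)
  show "step D u s R (index (Mu p)) x y \<longleftrightarrow>
     R (index p) (pair x y) 0 \<and> (\<forall>z<y. \<exists>v<s. 0 < v \<and> R (index p) (pair x z) v)"
    by (auto simp: *)
qed

section \<open>Soundness and completeness of the evaluator\<close>

lemma chi_eq_of_bool: "chi X x = of_bool (x \<in> X)"
  by (simp add: chi_def)

text \<open>Soundness, by induction on the stage. Agreement of \<open>D\<close> and \<open>X\<close>
  below \<open>u\<close> suffices because larger queries are never answered.\<close>

lemma run_if_computed:
  assumes D: "\<And>i. i < u \<Longrightarrow> i \<in> set_decode D \<longleftrightarrow> i \<in> X"
  shows "computed D u s (index p) x y \<Longrightarrow> run X p x = Some y"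
proof (induction s arbitrary: p x y)
  case 0 then show ?case by (simp add: computed_0)
next
  case (Suc s)
  show ?case
  proof (cases "computed D u s (index p) x y")
    case True then show ?thesis by (rule Suc.IH)
  next
    case False
    then have st: "step D u s (computed D u s) (index p) x y"
      using Suc.prems by (simp add: computed_Suc)
    show ?thesis
    proof (cases p)
      case Query
      then show ?thesis using st D by (auto simp: step_index chi_eq_of_bool simp del: index.simps)
    next
      case (Fork p q)
      then show ?thesis using st Suc.IH by (auto simp: step_index simp del: index.simps)
    next
      case (Comp p q)
      then show ?thesis using st Suc.IH by (auto simp: step_index simp del: index.simps)
    next
      case (PrimRec q r)
      obtain a n where x: "x = pair a n" by (metis prod_decode_inverse surj_pair)
      show ?thesis
      proof (cases n)
        case 0
        then show ?thesis using st Suc.IH PrimRec x by (simp add: step_index del: index.simps)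
      next
        case (Suc k)
        then obtain v where "computed D u s (index (PrimRec q r)) (pair a k) v"
          "computed D u s (index r) (triple a k v) y"
          using st PrimRec x by (auto simp: step_index simp del: index.simps)
        from this[THEN Suc.IH] show ?thesis using PrimRec x Suc by simp
      qed
    next
      case (Mu q)
      then have 0: "run X q (pair x y) = Some 0"
        and z: "\<And>z. z < y \<Longrightarrow> \<exists>v>0. run X q (pair x z) = Some v"
        using st Suc.IH by (auto simp: step_index simp del: index.simps)
      have "(LEAST y. run X q (pair x y) = Some 0) = y"
        using 0 z by (intro Least_equality) (fastforce simp: not_less[symmetric])+
      moreover have "\<exists>y. run X q (pair x y) = Some 0 \<and> (\<forall>z<y. run X q (pair x z) \<noteq> None)"
        using 0 z by fastforce
      ultimately show ?thesis using Mu by simp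
    qed (use st in \<open>auto simp: step_index simp del: index.simps\<close>)
  qed
qed

text \<open>\<open>N\<close> bounds the oracle use and the running time at once. Quantifying over
  all \<open>D\<close> that are correct below \<open>N\<close> lets the oracle approximation change
  from stage to stage.\<close>

definition settled :: "nat set \<Rightarrow> nat \<Rightarrow> nat \<Rightarrow> nat \<Rightarrow> nat \<Rightarrow> bool" where
  "settled X e x y N \<longleftrightarrow>
     (\<forall>D u s. N \<le> u \<longrightarrow> N \<le> s \<longrightarrow> (\<forall>i<N. i \<in> set_decode D \<longleftrightarrow> i \<in> X) \<longrightarrow> computed D u s e x y)"

lemma settledD:
  "settled X e x y N \<Longrightarrow> N \<le> u \<Longrightarrow> N \<le> s \<Longrightarrow> (\<And>i. i < N \<Longrightarrow> i \<in> set_decode D \<longleftrightarrow> i \<in> X) \<Longrightarrow>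
     computed D u s e x y"
  by (simp add: settled_def)

lemma eventually_settledI:
  assumes "\<forall>\<^sub>F N in sequentially. \<forall>D u s. N \<le> u \<longrightarrow> N \<le> s \<longrightarrow>
    (\<forall>i<N. i \<in> set_decode D \<longleftrightarrow> i \<in> X) \<longrightarrow> step D u s (computed D u s) e x y"
  shows "\<forall>\<^sub>F N in sequentially. settled X e x y N"
proof -
  obtain M where M: "\<And>N D u s. M \<le> N \<Longrightarrow> N \<le> u \<Longrightarrow> N \<le> s \<Longrightarrow>
    (\<forall>i<N. i \<in> set_decode D \<longleftrightarrow> i \<in> X) \<Longrightarrow> step D u s (computed D u s) e x y"
    using assms unfolding eventually_sequentially by blast
  have "settled X e x y N" if N: "max M (Suc (triple e x y)) < N" for N
    unfolding settled_def
  proof (intro allI impI)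
    fix D u s assume *: "N \<le> u" "N \<le> s" "\<forall>i<N. i \<in> set_decode D \<longleftrightarrow> i \<in> X"
    obtain s' where s: "s = Suc s'" using N *(2) by (cases s) auto
    \<comment> \<open>Being computed at \<open>s\<close> unfolds to a step at \<open>s - 1\<close>,
      so the hypothesis is applied with \<open>N - 1\<close>.\<close>
    have "step D u s' (computed D u s') e x y"
      by (rule M[of "N - 1"]) (use N * s in auto)
    then show "computed D u s e x y" using N *(2) s by (simp add: computed_Suc)
  qed
  then show ?thesis by (rule eventually_mono[OF eventually_gt_at_top])
qed

text \<open>The use principle: a convergent computation makes finitely many queries and passes
  through finitely many intermediate values, each of which must also lie below the search
  bound.\<close>

lemma eventually_settled:
  "run X p x = Some y \<Longrightarrow> \<forall>\<^sub>F N in sequentially. settled X (index p) x y N"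
proof (induction p arbitrary: x y)
  case Query
  show ?case
    by (rule eventually_settledI, rule eventually_mono[OF eventually_gt_at_top[of x]])
      (use Query in \<open>auto simp: step_index chi_eq_of_bool simp del: index.simps\<close>)
next
  case (Fork p q)
  then obtain a b where ab: "run X p x = Some a" "run X q x = Some b" "y = pair a b"
    by (auto simp: bind_eq_Some_conv)
  from Fork.IH(1)[OF ab(1)] Fork.IH(2)[OF ab(2)] show ?case
    by (intro eventually_settledI, eventually_elim)
      (auto simp: step_index ab(3) simp del: index.simps intro: settledD)
next
  case (Comp p q)
  then obtain v where v: "run X q x = Some v" "run X p v = Some y"
    by (auto simp: bind_eq_Some_conv)
  from Comp.IH(1)[OF v(2)] Comp.IH(2)[OF v(1)] eventually_gt_at_top[of v] show ?case
    by (intro eventually_settledI, eventually_elim)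
      (auto simp: step_index simp del: index.simps intro!: exI[of _ v] intro: settledD)
next
  case (PrimRec p q)
  obtain a n where x: "x = pair a n" by (metis prod_decode_inverse surj_pair)
  have "run X (PrimRec p q) (pair a n) = Some y \<Longrightarrow>
    \<forall>\<^sub>F N in sequentially. settled X (index (PrimRec p q)) (pair a n) y N"
  proof (induction n arbitrary: y)
    case 0
    then have "run X p a = Some y" by simp
    from PrimRec.IH(1)[OF this] show ?case
      by (intro eventually_settledI, eventually_elim)
        (auto simp: step_index simp del: index.simps intro: settledD)
  next
    case (Suc n)
    then obtain v where v: "run X (PrimRec p q) (pair a n) = Some v"
      "run X q (triple a n v) = Some y"
      by (auto simp: bind_eq_Some_conv)
    from Suc.IH[OF v(1)] PrimRec.IH(2)[OF v(2)] eventually_gt_at_top[of v] show ?case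
      by (intro eventually_settledI, eventually_elim)
        (auto simp: step_index simp del: index.simps intro!: exI[of _ v] intro: settledD)
  qed
  then show ?case using PrimRec.prems x by simp
next
  case (Mu p)
  from Mu.prems obtain y' where y': "run X p (pair x y') = Some 0"
    "\<forall>z<y'. run X p (pair x z) \<noteq> None" and y: "y = (LEAST y. run X p (pair x y) = Some 0)"
    by (auto split: if_splits)
  have 0: "run X p (pair x y) = Some 0" unfolding y using y'(1) by (rule LeastI)
  have "\<exists>v>0. run X p (pair x z) = Some v" if "z < y" for z
  proof -
    have "y \<le> y'" unfolding y using y'(1) by (rule Least_le)
    then have "z < y'" using that by simp
    then obtain v where "run X p (pair x z) = Some v" using y'(2) by blast
    moreover have "v \<noteq> 0" using not_less_Least[OF that[unfolded y]] calculation by auto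
    ultimately show ?thesis by blast
  qed
  then have "\<forall>z\<in>{..<y}. \<forall>\<^sub>F N in sequentially. \<exists>v<N. 0 < v \<and> settled X (index p) (pair x z) v N"
  proof (intro ballI)
    fix z assume "z \<in> {..<y}"
    then obtain v where v: "0 < v" "run X p (pair x z) = Some v"
      using \<open>\<And>z. z < y \<Longrightarrow> \<exists>v>0. run X p (pair x z) = Some v\<close> by auto
    from Mu.IH[OF v(2)] eventually_gt_at_top[of v]
    show "\<forall>\<^sub>F N in sequentially. \<exists>v<N. 0 < v \<and> settled X (index p) (pair x z) v N"
      by eventually_elim (use v in blast)
  qed
  \<comment> \<open>Only finitely many \<open>z\<close> precede the result of the search, so their
    bounds have a common one.\<close>
  then have "\<forall>\<^sub>F N in sequentially. \<forall>z\<in>{..<y}. \<exists>v<N. 0 < v \<and> settled X (index p) (pair x z) v N"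
    by (intro eventually_ball_finite) auto
  with Mu.IH[OF 0] show ?case
  proof (intro eventually_settledI, eventually_elim)
    case (elim N)
    show ?case
    proof (intro allI impI)
      fix D u s assume *: "N \<le> u" "N \<le> s" "\<forall>i<N. i \<in> set_decode D \<longleftrightarrow> i \<in> X"
      have "\<exists>v<s. 0 < v \<and> computed D u s (index p) (pair x z) v" if z: "z < y" for z
      proof -
        obtain v where "v < N" "0 < v" "settled X (index p) (pair x z) v N"
          using elim z by auto
        then show ?thesis using * by (intro exI[of _ v]) (auto intro: settledD)
      qed
      moreover have "computed D u s (index p) (pair x y) 0"
        using elim * by (auto intro: settledD)
      ultimately show "step D u s (computed D u s) (index (Mu p)) x y"
        by (simp add: step_index del: index.simps)
    qed
  qed
qed (rule eventually_settledI, simp add: step_index del: index.simps)+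

section \<open>Approximating the jump\<close>

text \<open>Searching all \<open>s\<close> up to \<open>t\<close> makes the approximation increasing
  in \<open>t\<close>. The code \<open>0\<close> stands for the empty oracle.\<close>

definition jump_approx :: "nat \<Rightarrow> nat set" where
  "jump_approx t = {k. k < t \<and> (\<exists>s<Suc t. \<exists>y<s. computed 0 s s k k y)}"

text \<open>Cutting off queries at the least number that has just entered is Lachlan's hat trick.
  The alternative \<open>k = t\<close> is the default when nothing enters.\<close>

definition least_new :: "nat \<Rightarrow> nat" where
  "least_new t = (LEAST k. k = t \<or> k \<in> jump_approx (Suc t) \<and> k \<notin> jump_approx t)"

text \<open>Queries at stage \<open>t\<close> will only be answered below \<open>least_new t\<close>. With this bound all answers
  are correct at infinitely many stages, while every query is eventually answered.\<close>

definition true_stage :: "nat \<Rightarrow> bool" where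
  "true_stage t \<longleftrightarrow> (\<forall>k<least_new t. k \<in> jump_approx (Suc t) \<longleftrightarrow> k \<in> zero_jump)"

lemma jump_approx_mono: "s \<le> t \<Longrightarrow> jump_approx s \<subseteq> jump_approx t"
  unfolding jump_approx_def by (auto dest: less_le_trans)

lemma finite_jump_approx: "finite (jump_approx t)"
  unfolding jump_approx_def by simp

lemma computed_le_args:
  assumes "computed D u s e x y"
  shows "x < s" "y < s"
  using computed_less[OF assms] le_prod_encode_2[of "pair x y" e] le_prod_encode_1[of x y]
    le_prod_encode_2[of y x] by linarith+

lemma eventually_computed_same:
  assumes "run {} p x = Some y"
  shows "\<forall>\<^sub>F s in sequentially. computed 0 s s (index p) x y"
  using eventually_settled[OF assms] by (rule eventually_mono) (auto intro: settledD)

lemma jump_approx_subset: "jump_approx t \<subseteq> zero_jump"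
proof
  fix k assume "k \<in> jump_approx t"
  then obtain s y where sy: "computed 0 s s k k y" by (auto simp: jump_approx_def)
  obtain p where "index p = k" using surj_index by blast
  with sy run_if_computed[of s 0 "{}" s p k y] show "k \<in> zero_jump"
    by (force simp: zero_jump_def)
qed

lemma zero_jump_imp_jump_approx:
  assumes "k \<in> zero_jump"
  shows "\<exists>t. k \<in> jump_approx t"
proof -
  obtain p y where p: "k = index p" "run {} p k = Some y"
    using assms by (auto simp: zero_jump_def)
  then obtain s where s: "computed 0 s s k k y"
    using eventually_computed_same[OF p(2)] by (auto simp: eventually_sequentially)
  then have "k < s" "y < s" by (rule computed_le_args)+
  then have "k \<in> jump_approx s" using s by (auto simp: jump_approx_def)
  then show ?thesis ..
qed

lemma eventually_jump_approx:
  "\<forall>\<^sub>F t in sequentially. \<forall>k<N. k \<in> jump_approx t \<longleftrightarrow> k \<in> zero_jump"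
proof -
  have "\<forall>\<^sub>F t in sequentially. k \<in> jump_approx t \<longleftrightarrow> k \<in> zero_jump" for k
  proof (cases "k \<in> zero_jump")
    case True
    then obtain t where "k \<in> jump_approx t" using zero_jump_imp_jump_approx by blast
    then have "k \<in> jump_approx t'" if "t \<le> t'" for t' using jump_approx_mono[OF that] by blast
    then show ?thesis using True by (intro eventually_sequentiallyI[of t]) blast
  next
    case False
    then show ?thesis using jump_approx_subset by (intro always_eventually) blast
  qed
  then have "\<forall>\<^sub>F t in sequentially. \<forall>k\<in>{..<N}. k \<in> jump_approx t \<longleftrightarrow> k \<in> zero_jump"
    by (intro eventually_ball_finite) auto
  then show ?thesis by (rule eventually_mono) auto
qed

lemma least_new_cases:
  "least_new t = t \<or> least_new t \<in> jump_approx (Suc t) \<and> least_new t \<notin> jump_approx t"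
  unfolding least_new_def by (rule LeastI_ex) blast

lemma least_new_le: "k \<in> jump_approx (Suc t) \<Longrightarrow> k \<notin> jump_approx t \<Longrightarrow> least_new t \<le> k"
  unfolding least_new_def by (rule Least_le) blast

text \<open>Once the approximation has settled below \<open>N\<close>, no number below
  \<open>N\<close> can enter any more, and the default value \<open>t\<close> exceeds
  \<open>N\<close> as well.\<close>

lemma eventually_least_new: "\<forall>\<^sub>F t in sequentially. N \<le> least_new t"
proof -
  have "\<forall>\<^sub>F t in sequentially. \<forall>k<N. k \<in> jump_approx (Suc t) \<longleftrightarrow> k \<in> zero_jump"
    using eventually_jump_approx[of N] by (rule eventually_sequentially_Suc[THEN iffD2])
  with eventually_jump_approx[of N] eventually_ge_at_top[of N] show ?thesis
  proof eventually_elim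
    case (elim t) then show ?case using least_new_cases[of t] by (metis not_less)
  qed
qed

text \<open>A stage from \<open>t0\<close> on that minimises \<open>least_new\<close> is true: an
  element of the jump below the minimum that is still missing would enter later, and
  \<open>least_new\<close> would then drop below the minimum.\<close>

lemma ex_true_stage: "\<exists>t\<ge>t0. true_stage t"
proof -
  define u where "u = (LEAST u. \<exists>t\<ge>t0. least_new t = u)"
  have "\<exists>t\<ge>t0. least_new t = u" unfolding u_def by (rule LeastI_ex) blast
  then obtain t where t: "t0 \<le> t" "least_new t = u" by blast
  have u_le: "u \<le> least_new t'" if "t0 \<le> t'" for t'
    unfolding u_def by (rule Least_le) (use that in blast)
  have "k \<in> jump_approx (Suc t)" if "k < u" "k \<in> zero_jump" for k
  proof (rule ccontr)
    assume k: "k \<notin> jump_approx (Suc t)"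
    obtain t1 where t1: "k \<in> jump_approx t1" using zero_jump_imp_jump_approx \<open>k \<in> zero_jump\<close> by blast
    have "Suc t \<le> t1" using k t1 jump_approx_mono[of t1 "Suc t"] by force
    then obtain t2 where "Suc t \<le> t2" "k \<notin> jump_approx t2" "k \<in> jump_approx (Suc t2)"
      using k t1 by (induction t1 rule: dec_induct) auto
    then show False using least_new_le[of k t2] u_le[of t2] t(1) \<open>k < u\<close> by simp
  qed
  then have "true_stage t" unfolding true_stage_def t(2) using jump_approx_subset by blast
  then show ?thesis using t(1) by blast
qed

text \<open>The part of the function \<open>n \<mapsto> \<phi>\<^sub>c (j, n)\<close>, with oracle \<open>0'\<close>, that is guessed at stage \<open>t\<close>.\<close>

definition guess :: "nat \<Rightarrow> nat \<Rightarrow> nat \<Rightarrow> nat \<Rightarrow> nat \<Rightarrow> bool" where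
  "guess c j t n y \<longleftrightarrow>
     computed (set_encode (jump_approx (Suc t))) (least_new t) t c (pair j n) y"

lemma guess_less:
  assumes "guess c j t n y"
  shows "n < t" "y < t"
  using computed_le_args[OF assms[unfolded guess_def]] le_prod_encode_2[of n j] by linarith+

text \<open>All answered queries lie below \<open>least_new\<close>, where a true stage agrees with
  the jump.\<close>

lemma guess_true_stage:
  assumes "true_stage t" "guess (index p) j t n y"
  shows "run zero_jump p (pair j n) = Some y"
  by (rule run_if_computed[OF _ assms(2)[unfolded guess_def]])
    (use assms(1) in \<open>simp add: true_stage_def set_encode_inverse finite_jump_approx\<close>)

text \<open>Both \<open>least_new\<close> and the correct part of the approximation outgrow the use
  of the computation.\<close>

lemma eventually_guess:
  assumes "run zero_jump p (pair j n) = Some y"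
  shows "\<forall>\<^sub>F t in sequentially. guess (index p) j t n y"
proof -
  obtain N where N: "settled zero_jump (index p) (pair j n) y N"
    using eventually_settled[OF assms] by (auto simp: eventually_sequentially)
  have "\<forall>\<^sub>F t in sequentially. \<forall>k<N. k \<in> jump_approx (Suc t) \<longleftrightarrow> k \<in> zero_jump"
    using eventually_jump_approx[of N] by (rule eventually_sequentially_Suc[THEN iffD2])
  with eventually_least_new[of N] eventually_ge_at_top[of N] show ?thesis
    unfolding guess_def
    by eventually_elim
      (auto intro!: settledD[OF N] simp: set_encode_inverse finite_jump_approx)
qed

lemma decidable_jump_approx[computable_intros]:
  assumes "computable f" "computable g"
  shows "decidable (\<lambda>x. f x \<in> jump_approx (g x))"
  unfolding jump_approx_def mem_Collect_eq
  by (intro computable_intros assms computable_comp[OF assms(1)])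

lemma computable_least_new[computable_intros]:
  assumes "computable f"
  shows "computable (\<lambda>x. least_new (f x))"
proof -
  have "computable least_new"
    unfolding least_new_def[abs_def] by (rule computable_Least) (intro computable_intros, blast)
  then show ?thesis using assms by (rule computable_comp)
qed

lemma decidable_guess[computable_intros]:
  assumes "computable c" "computable j" "computable t" "computable n" "computable y"
  shows "decidable (\<lambda>x. guess (c x) (j x) (t x) (n x) (y x))"
proof -
  \<comment> \<open>The explicit bound brings the set into the form for which codes are known to be
    computable.\<close>
  have *: "jump_approx s = {k. k < s \<and> k \<in> jump_approx s}" for s by (auto simp: jump_approx_def)
  have "computable (\<lambda>s. set_encode (jump_approx (Suc s)))"
    by (subst *) (intro computable_intros)
  from computable_comp[OF this assms(3)] show ?thesis
    unfolding guess_def by (intro computable_intros assms)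
qed

section \<open>String codes\<close>

lemma Suc_str_code_Cons: "Suc (str_code (b # s)) = 2 * Suc (str_code s) + of_bool b"
  by simp

lemma Suc_str_code_bounds:
  "2 ^ length s \<le> Suc (str_code s)" "Suc (str_code s) < 2 ^ Suc (length s)"
  by (induction s) (simp_all split: if_splits)

lemma Suc_str_code_bit:
  "n < length s \<Longrightarrow> n \<in> set_decode (Suc (str_code s)) \<longleftrightarrow> s ! n"
proof (induction s arbitrary: n)
  case (Cons b s)
  show ?case
  proof (cases n)
    case 0 then show ?thesis unfolding Suc_str_code_Cons by simp
  next
    case (Suc m)
    have "(2 * Suc (str_code s) + of_bool b) div 2 = Suc (str_code s)" by simp
    then show ?thesis using Suc Cons unfolding Suc_str_code_Cons Suc set_decode_Suc by simp
  qed
qed simp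

text \<open>The leading binary digit of the successor of the code sits at position
  \<open>length s\<close>. This turns a condition on strings into decidable arithmetic on
  codes.\<close>

lemma less_length_iff: "n < length s \<longleftrightarrow> 2 ^ Suc n \<le> Suc (str_code s)"
proof
  assume "n < length s"
  then have "(2 :: nat) ^ Suc n \<le> 2 ^ length s" by (intro power_increasing) auto
  then show "2 ^ Suc n \<le> Suc (str_code s)" using Suc_str_code_bounds(1) le_trans by blast
next
  assume "2 ^ Suc n \<le> Suc (str_code s)"
  then have "(2 :: nat) ^ Suc n < 2 ^ Suc (length s)"
    using Suc_str_code_bounds(2) le_less_trans by blast
  then have "Suc n < Suc (length s)" by (rule power_less_imp_less_exp[rotated]) simp
  then show "n < length s" by simp
qed

abbreviation initial :: "nat set \<Rightarrow> nat \<Rightarrow> bool list" where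
  "initial X n \<equiv> map (\<lambda>i. i \<in> X) [0..<n]"

section \<open>Density\<close>

text \<open>Complements are easier to estimate: their counts are subadditive and shrink when the set
  grows.\<close>

lemma density1_iff: "density1 X \<longleftrightarrow> (\<lambda>n. real (card ({..<n} - X)) / real n) \<longlonglongrightarrow> 0"
proof -
  have *: "\<forall>\<^sub>F n in sequentially.
    1 - real (card (X \<inter> {..<n})) / real n = real (card ({..<n} - X)) / real n"
    using eventually_gt_at_top[of 0]
  proof eventually_elim
    case (elim n)
    have "{..<n} - X \<union> X \<inter> {..<n} = {..<n}" "({..<n} - X) \<inter> (X \<inter> {..<n}) = {}" by auto
    then have "card ({..<n} - X) + card (X \<inter> {..<n}) = card {..<n}"
      by (metis card_Un_disjoint finite_Diff finite_Int finite_lessThan)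
    then have "real (card ({..<n} - X)) + real (card (X \<inter> {..<n})) = real n"
      by (simp flip: of_nat_add)
    then show ?case using elim by (simp add: field_simps)
  qed
  have "density1 X \<longleftrightarrow> (\<lambda>n. 1 - real (card (X \<inter> {..<n})) / real n) \<longlonglongrightarrow> 0"
    unfolding density1_def
    using tendsto_diff[OF tendsto_const[of "1::real"], of _ 1]
      tendsto_diff[OF tendsto_const[of "1::real"], of "\<lambda>n. 1 - real (card (X \<inter> {..<n})) / real n" 0]
    by fastforce
  then show ?thesis using tendsto_cong[OF *] by simp
qed

lemma density1_Int:
  assumes "density1 X" "density1 Y"
  shows "density1 (X \<inter> Y)"
  unfolding density1_iff
proof (rule Lim_null_comparison)
  have "(\<lambda>n. real (card ({..<n} - X)) / real n + real (card ({..<n} - Y)) / real n) \<longlonglongrightarrow> 0 + 0"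
    using assms unfolding density1_iff by (rule tendsto_add)
  then show "(\<lambda>n. real (card ({..<n} - X)) / real n + real (card ({..<n} - Y)) / real n) \<longlonglongrightarrow> 0"
    by simp
  have "card ({..<n} - X \<inter> Y) \<le> card ({..<n} - X) + card ({..<n} - Y)" for n
    unfolding Diff_Int by (rule card_Un_le)
  then show "\<forall>\<^sub>F n in sequentially. norm (real (card ({..<n} - X \<inter> Y)) / real n)
      \<le> real (card ({..<n} - X)) / real n + real (card ({..<n} - Y)) / real n"
    by (intro always_eventually allI)
      (simp add: divide_right_mono flip: add_divide_distrib of_nat_add)
qed

lemma density1_superset:
  assumes "density1 X" "X \<subseteq> Y"
  shows "density1 Y"
  unfolding density1_iff
proof (rule Lim_null_comparison)
  have "card ({..<n} - Y) \<le> card ({..<n} - X)" for n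
    using assms(2) by (intro card_mono) auto
  then show "\<forall>\<^sub>F n in sequentially.
      norm (real (card ({..<n} - Y)) / real n) \<le> real (card ({..<n} - X)) / real n"
    by (intro always_eventually allI) (simp add: divide_right_mono)
  show "(\<lambda>n. real (card ({..<n} - X)) / real n) \<longlonglongrightarrow> 0"
    using assms(1) by (simp add: density1_iff)
qed

text \<open>The multiples of \<open>2 ^ e\<close> have density \<open>(1 / 2) ^ e\<close>, which is
  arbitrarily small, and a finite remainder has density 0.\<close>

lemma density1_if_cofinite_off_multiples:
  assumes fin: "\<And>e. finite {z. z \<notin> X \<and> \<not> 2 ^ e dvd z}"
  shows "density1 X"
  unfolding density1_iff
proof (rule tendstoI)
  fix \<epsilon> :: real assume "0 < \<epsilon>"
  then obtain e where e: "(1 / 2) ^ e < \<epsilon> / 2"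
    using real_arch_pow_inv[of "\<epsilon> / 2" "1 / 2"] by auto
  \<comment> \<open>The extra 1 pays for the multiple 0 of \<open>2 ^ e\<close>.\<close>
  define C where "C = card {z. z \<notin> X \<and> \<not> 2 ^ e dvd z} + 1"
  have "(\<lambda>n. real C / real n) \<longlonglongrightarrow> 0" by (rule lim_const_over_n)
  then have "\<forall>\<^sub>F n in sequentially. real C / real n < \<epsilon> / 2"
    by (rule order_tendstoD) (use \<open>0 < \<epsilon>\<close> in simp)
  with eventually_gt_at_top[of 0]
  show "\<forall>\<^sub>F n in sequentially. dist (real (card ({..<n} - X)) / real n) 0 < \<epsilon>"
  proof eventually_elim
    case (elim n)
    have "{..<n} - X \<subseteq> {z. z \<notin> X \<and> \<not> 2 ^ e dvd z} \<union> (\<lambda>k. 2 ^ e * k) ` {..n div 2 ^ e}"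
      by (auto simp: dvd_def image_iff less_eq_div_iff_mult_less_eq ac_simps)
    then have "card ({..<n} - X)
        \<le> card ({z. z \<notin> X \<and> \<not> 2 ^ e dvd z} \<union> (\<lambda>k. 2 ^ e * k) ` {..n div 2 ^ e})"
      by (rule card_mono[rotated]) (use fin in simp)
    also have "\<dots> \<le> card {z. z \<notin> X \<and> \<not> 2 ^ e dvd z} + card ((\<lambda>k. 2 ^ e * k) ` {..n div 2 ^ e})"
      by (rule card_Un_le)
    also have "\<dots> \<le> C + n div 2 ^ e"
      using card_image_le[of "{..n div 2 ^ e}" "\<lambda>k. 2 ^ e * k"] by (simp add: C_def)
    finally have "real (card ({..<n} - X)) \<le> real C + real (n div 2 ^ e)"
      by (simp flip: of_nat_add)
    also have "\<dots> \<le> real C + real n * (1 / 2) ^ e"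
      using of_nat_div_le_of_nat[of n "2 ^ e", where 'a = real] by (simp add: power_divide)
    finally have "real (card ({..<n} - X)) / real n \<le> real C / real n + (1 / 2) ^ e"
      using elim(1) by (simp add: field_simps)
    then have "real (card ({..<n} - X)) / real n < \<epsilon>" using elim(2) e by linarith
    then show ?case by simp
  qed
qed

text \<open>The factor \<open>2 ^ t\<close> lets a single block make up a fixed proportion of an initial
  segment of the natural numbers, so a set of density 1 meets almost all blocks of a column.\<close>

definition block :: "nat \<Rightarrow> nat \<Rightarrow> nat \<Rightarrow> bool" where
  "block e t z \<longleftrightarrow> 2 ^ t \<le> z \<and> z < 2 ^ Suc t \<and> (\<exists>k<z. z = 2 ^ e * (2 * k + 1))"

text \<open>The column is the exponent of 2 in the number.\<close>

lemma column_unique: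
  "2 ^ e * (2 * k + 1) = 2 ^ e' * (2 * k' + 1) \<Longrightarrow> e = e'" for e k :: nat
proof (induction e arbitrary: e')
  case 0
  show ?case
  proof (cases e')
    case (Suc d)
    then have "even (2 * k + 1)" using 0 by simp
    then show ?thesis by simp
  qed simp
next
  case (Suc e)
  show ?case
  proof (cases e')
    case 0
    then have "even (2 * k' + 1)" using Suc.prems by (metis dvd_mult2 dvd_triv_left mult_1 power_0 power_Suc)
    then show ?thesis by simp
  next
    case (Suc d) then show ?thesis using Suc.prems Suc.IH[of d] by simp
  qed
qed

lemma block_unique:
  assumes "block e t z" "block e' t' z"
  shows "e = e'" "t = t'"
proof -
  show "e = e'" using assms column_unique unfolding block_def by metis
  have "(2 :: nat) ^ t < 2 ^ Suc t'" "(2 :: nat) ^ t' < 2 ^ Suc t"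
    using assms unfolding block_def by linarith+
  then have "t < Suc t'" "t' < Suc t"
    using power_less_imp_less_exp[of "2 :: nat"] one_less_numeral_iff semiring_norm(76) by blast+
  then show "t = t'" by simp
qed

lemma ex_block:
  assumes "0 < z"
  shows "\<exists>e t. block e t z"
proof -
  have "\<exists>e k. z = 2 ^ e * (2 * k + 1)"
    using assms
  proof (induction z rule: less_induct)
    case (less z)
    show ?case
    proof (cases "even z")
      case True
      then obtain m where m: "z = 2 * m" by blast
      then obtain e k where "m = 2 ^ e * (2 * k + 1)" using less.IH[of m] less.prems by auto
      then have "z = 2 ^ Suc e * (2 * k + 1)" using m by simp
      then show ?thesis by blast
    next
      case False
      then obtain k where "z = 2 * k + 1" by (auto elim: oddE)
      then have "z = 2 ^ 0 * (2 * k + 1)" by simp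
      then show ?thesis by blast
    qed
  qed
  then obtain e k where ek: "z = 2 ^ e * (2 * k + 1)" by blast
  have "1 * k < 2 ^ e * (2 * k + 1)" by (rule le_less_trans[OF mult_le_mono1[of 1 "2 ^ e"]]) auto
  then have "k < z" by (simp add: ek)
  moreover obtain t where "2 ^ t \<le> z" "z < 2 ^ (t + 1)"
    using ex_power_ivl1[of 2 z] assms by auto
  ultimately show ?thesis unfolding block_def using ek by auto
qed

lemma block_column_dvd: "block e t z \<Longrightarrow> d \<le> e \<Longrightarrow> 2 ^ d dvd z"
  unfolding block_def by (metis dvd_mult2 le_imp_power_dvd)

lemma finite_block: "finite {z. block e t z}"
  by (rule finite_subset[of _ "{..<2 ^ Suc t}"]) (auto simp: block_def)

text \<open>The \<open>2 ^ d\<close> numbers \<open>k\<close> with exactly \<open>d + 1\<close>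
  binary digits give the elements: for them \<open>2 ^ e * (2 * k + 1)\<close> has exactly
  \<open>e + d + 2\<close> digits.\<close>

lemma card_block: "2 ^ d \<le> card {z. block e (e + 1 + d) z}"
proof -
  have "(\<lambda>k. 2 ^ e * (2 * k + 1)) ` {2 ^ d..<2 ^ Suc d} \<subseteq> {z. block e (e + 1 + d) z}"
  proof (clarify)
    fix k :: nat assume k: "k \<in> {2 ^ d..<2 ^ Suc d}"
    have "2 ^ e * (2 * 2 ^ d) \<le> 2 ^ e * (2 * k + 1)" using k by (intro mult_le_mono2) simp
    moreover have "2 ^ e * (2 * k + 1) < 2 ^ e * (2 * 2 ^ Suc d)"
      using k by (intro mult_less_mono2) auto
    moreover have "1 * k < 2 ^ e * (2 * k + 1)"
      by (rule le_less_trans[OF mult_le_mono1[of 1 "2 ^ e"]]) auto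
    ultimately show "block e (e + 1 + d) (2 ^ e * (2 * k + 1))"
      unfolding block_def by (auto simp: power_add)
  qed
  then have "card ((\<lambda>k. 2 ^ e * (2 * k + 1)) ` {2 ^ d..<2 ^ Suc d :: nat})
      \<le> card {z. block e (e + 1 + d) z}"
    by (rule card_mono[OF finite_block])
  moreover have "inj_on (\<lambda>k. 2 ^ e * (2 * k + 1)) {2 ^ d..<2 ^ Suc d :: nat}"
    by (auto simp: inj_on_def)
  ultimately show ?thesis by (simp add: card_image)
qed

text \<open>With \<open>t = e + 1 + d\<close>, a missed block costs at least \<open>2 ^ d\<close> of
  the first \<open>2 ^ (e + 2 + d)\<close> numbers, a proportion that depends on \<open>e\<close>
  alone.\<close>

lemma eventually_density1_meets_block:
  assumes "density1 V"
  shows "\<forall>\<^sub>F t in sequentially. \<exists>z\<in>V. block e t z"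
proof -
  have "\<forall>\<^sub>F n in sequentially. real (card ({..<n} - V)) / real n < (1 / 2) ^ (e + 2)"
    using assms unfolding density1_iff by (rule order_tendstoD) simp
  then obtain N where N: "\<And>n. N \<le> n \<Longrightarrow> real (card ({..<n} - V)) / real n < (1 / 2) ^ (e + 2)"
    unfolding eventually_sequentially by blast
  show ?thesis
  proof (rule eventually_sequentiallyI)
    fix t assume t: "N + (e + 1) \<le> t"
    then obtain d where d: "t = e + 1 + d" by (metis add.commute add_leD2 le_Suc_ex)
    show "\<exists>z\<in>V. block e t z"
    proof (rule ccontr)
      assume none: "\<not> (\<exists>z\<in>V. block e t z)"
      have "{z. block e t z} \<subseteq> {..<2 ^ Suc t} - V" using none by (auto simp: block_def)
      then have "2 ^ d \<le> card ({..<2 ^ Suc t} - V)"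
        using card_block[of d e] card_mono[of "{..<2 ^ Suc t} - V" "{z. block e t z}"] d by simp
      then have "(2 :: real) ^ d \<le> real (card ({..<2 ^ Suc t} - V))"
        by (metis of_nat_le_iff of_nat_numeral of_nat_power)
      moreover have "N \<le> 2 ^ Suc t"
        using t less_exp[of "Suc t"] by linarith
      from N[OF this] have "real (card ({..<2 ^ Suc t} - V)) < (1 / 2) ^ (e + 2) * 2 ^ Suc t"
        by (subst (asm) pos_divide_less_eq) simp_all
      moreover have "(1 / 2 :: real) ^ (e + 2) * 2 ^ Suc t = 2 ^ d"
        by (simp add: d power_add power_divide)
      ultimately show False by simp
    qed
  qed
qed

lemma decidable_block[computable_intros]:
  assumes "computable e" "computable t" "computable z"
  shows "decidable (\<lambda>x. block (e x) (t x) (z x))"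
  unfolding block_def
  by (intro computable_intros assms computable_comp[OF assms(1)] computable_comp[OF assms(3)])

section \<open>A parametrised recursion theorem\<close>

lemma Mu_computes:
  assumes "\<And>x y. run X q (pair x y) = Some (of_bool (\<not> P x y))"
  shows "run X (Mu q) x \<noteq> None \<longleftrightarrow> (\<exists>y. P x y)"
  using assms by auto

text \<open>Hard-wires a number into a program, as the s-m-n theorem requires.\<close>

primrec const_prog :: "nat \<Rightarrow> prog" where
  "const_prog 0 = Zero"
| "const_prog (Suc n) = Comp Succ (const_prog n)"

lemma run_const_prog: "run X (const_prog n) x = Some n"
  by (induction n) auto

lemma computable_index_const_prog[computable_intros]:
  assumes "computable f"
  shows "computable (\<lambda>x. index (const_prog (f x)))"
proof -
  have "rec_nat 0 (\<lambda>k r. 6 + 4 * pair 1 r) n = index (const_prog n)" for n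
    by (induction n) auto
  moreover have "computable (\<lambda>x. rec_nat 0 (\<lambda>k r. 6 + 4 * pair 1 r) (f x))"
    by (intro computable_intros assms)
  ultimately show ?thesis by simp
qed

text \<open>Kleene's recursion theorem with a parameter \<open>e\<close>: the enumeration may refer
  to its own index \<open>i e\<close>, and \<open>i\<close> is computable by s-m-n.\<close>

lemma recursion_theorem:
  assumes Q: "decidable (\<lambda>z. Q (pfst z) (pfst (psnd z)) (pfst (psnd (psnd z))) (psnd (psnd (psnd z))))"
  obtains i where "computable i"
    "\<And>e. \<exists>p. index p = i e \<and> dom (run {} p) = {x. \<exists>s. Q (i e) e x s}"
proof -
  text \<open>The index of the program \<open>x \<mapsto> \<phi>\<^sub>c (c, e, x)\<close>, as a function of \<open>c\<close> and \<open>e\<close>.\<close>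
  define d where "d c e = 6 + 4 * pair c (index (Fork (const_prog c)
      (Fork (const_prog e) (Fork Fst Snd))))" for c e
  have d: "computable (\<lambda>z. d (f z) (g z))" if "computable f" "computable g" for f g
    unfolding d_def index.simps by (intro computable_intros that)
  define R where "R z s \<longleftrightarrow> Q (d (pfst z) (pfst (psnd z))) (pfst (psnd z)) (psnd (psnd z)) s" for z s
  have "decidable (\<lambda>w. R (pfst w) (psnd w))"
    unfolding R_def by (intro decidable_comp4[OF Q] computable_intros d)
  then have "computable (\<lambda>w. of_bool (\<not> R (pfst w) (psnd w)))"
    by (intro computable_intros)
  from computableD[OF this] obtain q where
    q: "\<And>X. run X q = (\<lambda>w. Some (of_bool (\<not> R (pfst w) (psnd w))))"
    by blast
  \<comment> \<open>Self-application: the search program receives its own index as \<open>c\<close>,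
    so the value \<open>d c e\<close> in \<open>R\<close> is the index of the very program being
    run.\<close>
  define i where "i = d (index (Mu q))"
  show thesis
  proof
    show "computable i" unfolding i_def by (intro d computable_intros)
  next
    fix e
    let ?p = "Comp (Mu q) (Fork (const_prog (index (Mu q))) (Fork (const_prog e) (Fork Fst Snd)))"
    have "run {} ?p x = run {} (Mu q) (triple (index (Mu q)) e x)" for x
      by (simp add: run_const_prog del: index.simps run.simps(9))
    moreover have "run {} (Mu q) (triple (index (Mu q)) e x) \<noteq> None \<longleftrightarrow> (\<exists>s. Q (i e) e x s)" for x
      by (subst Mu_computes[where P = R]) (simp_all add: q R_def[abs_def] i_def del: index.simps)
    ultimately have "dom (run {} ?p) = {x. \<exists>s. Q (i e) e x s}"
      by (simp add: dom_def del: run.simps index.simps)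
    moreover have "index ?p = i e" by (simp add: i_def d_def)
    ultimately show "\<exists>p. index p = i e \<and> dom (run {} p) = {x. \<exists>s. Q (i e) e x s}" by blast
  qed
qed

section \<open>The trees and the density-1 set\<close>

text \<open>In the following, \<open>c\<close> is an index of the functional that computes paths from \<open>0'\<close>, \<open>j\<close> is
  to be an index of the tree itself, and \<open>e\<close> is an index of a potential generic computation.\<close>

definition extends :: "nat \<Rightarrow> nat \<Rightarrow> nat \<Rightarrow> nat \<Rightarrow> bool" where
  "extends c j x t \<longleftrightarrow> (\<forall>n<t. \<forall>y<t. guess c j t n y \<longrightarrow>
     2 ^ Suc n \<le> Suc x \<and> y = of_bool (n \<in> set_decode (Suc x)))"

definition hit :: "nat \<Rightarrow> nat \<Rightarrow> nat \<Rightarrow> bool" where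
  "hit e r s \<longleftrightarrow> (\<exists>z<s. block e r z \<and> computed 0 s s e z 1)"

definition removed :: "nat \<Rightarrow> nat \<Rightarrow> nat \<Rightarrow> nat \<Rightarrow> nat \<Rightarrow> bool" where
  "removed c j e x s \<longleftrightarrow> (\<exists>r<s. hit e r s \<and> extends c j x r)"

definition guess_tree :: "nat \<Rightarrow> nat \<Rightarrow> nat \<Rightarrow> bool list set" where
  "guess_tree c j e = {\<sigma>. \<forall>s. \<not> removed c j e (str_code \<sigma>) s}"

text \<open>By stage \<open>t\<close> the tree is seen to have no string of length \<open>t\<close>.\<close>

definition dead :: "nat \<Rightarrow> nat \<Rightarrow> nat \<Rightarrow> nat \<Rightarrow> bool" where
  "dead c j e t \<longleftrightarrow>
     (\<forall>x<2 ^ Suc t. 2 ^ t \<le> Suc x \<and> Suc x < 2 ^ Suc t \<longrightarrow> (\<exists>s<t. removed c j e x s))"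

text \<open>Enumeration is positive in \<open>P\<close>: one visible disagreement suffices, and
  missing information only delays or prevents it.\<close>

definition enumerated :: "nat \<Rightarrow> (nat \<Rightarrow> nat) \<Rightarrow> (nat \<times> nat \<times> nat) set \<Rightarrow> nat set" where
  "enumerated c i P = {z. \<exists>e t. block e t z \<and>
     (dead c (i e) e t \<or> (\<exists>n x l y. (n, x, l) \<in> P \<and> guess c (i e) t n y \<and> y \<noteq> x))}"

definition compatible :: "nat \<Rightarrow> nat \<Rightarrow> nat \<Rightarrow> nat set \<Rightarrow> bool" where
  "compatible c j t X \<longleftrightarrow> (\<forall>n y. guess c j t n y \<longrightarrow> y = chi X n)"

text \<open>The bounds on \<open>n\<close> and \<open>y\<close> in \<open>extends\<close> lose
  nothing, since a stage guesses only arguments and values below itself.\<close>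

lemma extends_iff:
  "extends c j (str_code \<sigma>) t \<longleftrightarrow> (\<forall>n y. guess c j t n y \<longrightarrow> n < length \<sigma> \<and> y = of_bool (\<sigma> ! n))"
proof -
  have "(n < length \<sigma> \<and> y = of_bool (n \<in> set_decode (Suc (str_code \<sigma>))))
      \<longleftrightarrow> (n < length \<sigma> \<and> y = of_bool (\<sigma> ! n))" for n y :: nat
    using Suc_str_code_bit by auto
  then show ?thesis unfolding extends_def less_length_iff[symmetric]
    by (simp only:) (meson guess_less)
qed

lemma extends_initial:
  "compatible c j t X \<Longrightarrow> t \<le> m \<Longrightarrow> extends c j (str_code (initial X m)) t"
  unfolding extends_iff compatible_def using guess_less(1) by (fastforce simp: chi_eq_of_bool)

lemma compatible_if_extends_initial:
  "extends c j (str_code (initial X m)) t \<Longrightarrow> compatible c j t X"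
  unfolding extends_iff compatible_def by (fastforce simp: chi_eq_of_bool)

text \<open>A longer string extends every guess that its prefix extends, so the same hit removes
  it.\<close>

lemma removed_prefix:
  assumes "removed c j e (str_code \<sigma>) s" "prefix \<sigma> \<tau>"
  shows "removed c j e (str_code \<tau>) s"
proof -
  obtain \<rho> where "\<tau> = \<sigma> @ \<rho>" using assms(2) by (auto simp: prefix_def)
  then have "extends c j (str_code \<tau>) r" if "extends c j (str_code \<sigma>) r" for r
    using that unfolding extends_iff by (auto simp: nth_append intro: trans_less_add1)
  then show ?thesis using assms(1) unfolding removed_def by blast
qed

lemma is_tree_guess_tree: "is_tree (guess_tree c j e)"
  unfolding is_tree_def guess_tree_def using removed_prefix by blast

lemma decidable_removed[computable_intros]:
  assumes "computable c" "computable j" "computable e" "computable x" "computable s"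
  shows "decidable (\<lambda>z. removed (c z) (j z) (e z) (x z) (s z))"
proof -
  note * = assms assms[THEN computable_comp]
  show ?thesis unfolding removed_def hit_def extends_def
    by (intro computable_intros *)
qed

lemma decidable_dead[computable_intros]:
  assumes "computable c" "computable j" "computable e" "computable t"
  shows "decidable (\<lambda>z. dead (c z) (j z) (e z) (t z))"
proof -
  note * = assms assms[THEN computable_comp]
  show ?thesis unfolding dead_def by (intro computable_intros *)
qed

text \<open>The tree is defined from guesses at the path computed from its own index; the recursion
  theorem resolves this circularity uniformly in \<open>e\<close>.\<close>

lemma ex_tree_indices:
  obtains i where "computable i" "\<And>e. pi01_index (i e) (guess_tree c (i e) e)"
proof -
  have "decidable (\<lambda>z. removed c (pfst z) (pfst (psnd z)) (pfst (psnd (psnd z))) (psnd (psnd (psnd z))))"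
    by (intro computable_intros)
  then obtain i where i: "computable i"
    "\<And>e. \<exists>p. index p = i e \<and> dom (run {} p) = {x. \<exists>s. removed c (i e) e x s}"
    by (rule recursion_theorem[of "removed c"]) blast
  have "- guess_tree c (i e) e = str_code -` {x. \<exists>s. removed c (i e) e x s}" for e
    by (auto simp: guess_tree_def)
  then have "{x. \<exists>s. removed c (i e) e x s} = tree_real (- guess_tree c (i e) e)" for e
    by (simp only: tree_real_def surj_image_vimage_eq[OF bij_is_surj[OF bij_str_code]])
  with i(2) have "pi01_index (i e) (guess_tree c (i e) e)" for e
    unfolding pi01_index_def by metis
  with i(1) show thesis by (rule that)
qed

text \<open>One functional serves all \<open>P\<close>: it searches for a column, a stage and either
  a dead tree or a triple of the oracle that contradicts a guessed value.\<close>

lemma ex_enumerating_prog: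
  assumes "computable i"
  shows "\<exists>q. \<forall>P. run (triples_real P) q = (\<lambda>z. if z \<in> enumerated c i P then Some 1 else None)"
proof -
  define S where "S z e t \<longleftrightarrow> block e t z \<and> dead c (i e) e t" for z e t
  define G where "G z e t a y \<longleftrightarrow> block e t z \<and> guess c (i e) t (pfst a) y \<and> y \<noteq> pfst (psnd a)"
    for z e t a y
  define R where "R Y z w \<longleftrightarrow> S z (pfst w) (pfst (psnd w)) \<or>
      G z (pfst w) (pfst (psnd w)) (pfst (psnd (psnd w))) (psnd (psnd (psnd w))) \<and>
      pfst (psnd (psnd w)) \<in> Y" for Y z w
  \<comment> \<open>The decidable part knows no oracle, so the answer to the query is passed to it
    as \<open>psnd v\<close>.\<close>
  define h :: "nat \<Rightarrow> nat" where "h v = of_bool (\<not> (S (pfst (pfst v)) (pfst (psnd (pfst v))) (pfst (psnd (psnd (pfst v)))) \<or>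
      G (pfst (pfst v)) (pfst (psnd (pfst v))) (pfst (psnd (psnd (pfst v))))
        (pfst (psnd (psnd (psnd (pfst v))))) (psnd (psnd (psnd (psnd (pfst v))))) \<and> psnd v = 1))"
    for v
  have "computable h" unfolding h_def[abs_def] S_def G_def
    by (intro computable_intros computable_comp[OF assms])
  from computableD[OF this] obtain qh where qh: "\<And>X. run X qh = (\<lambda>v. Some (h v))" by blast
  have "computable (\<lambda>v. pfst (psnd (psnd (psnd v))))" by (intro computable_intros)
  from computableD[OF this] obtain qa where
    qa: "\<And>X. run X qa = (\<lambda>v. Some (pfst (psnd (psnd (psnd v)))))" by blast
  \<comment> \<open>\<open>Fork Fst Snd\<close> is the identity, so \<open>qh\<close> sees the input
    next to the answer to the single query.\<close>
  define q where "q = Comp qh (Fork (Fork Fst Snd) (Comp Query qa))"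
  have q: "run Y q (pair z w) = Some (of_bool (\<not> R Y z w))" for Y z w
    by (simp add: q_def qh qa h_def R_def chi_def)
  have R: "(\<exists>w. R (triples_real P) z w) \<longleftrightarrow> z \<in> enumerated c i P" for P z
  proof
    assume "\<exists>w. R (triples_real P) z w"
    then show "z \<in> enumerated c i P"
      unfolding R_def S_def G_def enumerated_def triples_real_def by fastforce
  next
    assume "z \<in> enumerated c i P"
    then obtain e t where et: "block e t z" and
      *: "dead c (i e) e t \<or> (\<exists>n x l y. (n, x, l) \<in> P \<and> guess c (i e) t n y \<and> y \<noteq> x)"
      unfolding enumerated_def by blast
    from * show "\<exists>w. R (triples_real P) z w"
    proof (elim disjE exE conjE)
      assume "dead c (i e) e t"
      then show ?thesis using et by (intro exI[of _ "triple e t 0"]) (simp add: R_def S_def)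
    next
      fix n x l y assume "(n, x, l) \<in> P" "guess c (i e) t n y" "y \<noteq> x"
      then show ?thesis using et
        by (intro exI[of _ "triple e t (pair (triple n x l) y)"])
          (auto simp: R_def G_def triples_real_def)
    qed
  qed
  have "run (triples_real P) (Comp (const_prog 1) (Mu q)) z
      = (if z \<in> enumerated c i P then Some 1 else None)" for P z
    using Mu_computes[of "triples_real P" q "R (triples_real P)" z, OF q] R[of P z]
    by (auto simp: run_const_prog bind_eq_Some_conv simp del: run.simps(9))
  then show ?thesis by blast
qed

section \<open>Consequences of infinite and of finite trees\<close>

lemma infinite_if_path:
  assumes "path_through X T"
  shows "infinite T"
proof
  assume "finite T"
  then have "finite (range (initial X))"
    by (rule finite_subset[rotated]) (use assms in \<open>auto simp: path_through_def\<close>)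
  moreover have "inj (initial X)" by (rule injI) (metis diff_zero length_map length_upt)
  ultimately show False by (simp add: finite_image_iff)
qed

text \<open>At a true stage the guess is an initial part of \<open>X\<close>, so a hit in the corresponding block
  would have removed \<open>X\<close> from the tree.\<close>

lemma not_density1_if_path:
  assumes path: "path_through X (guess_tree (index p) j (index q))"
    and X: "\<And>n. run zero_jump p (pair j n) = Some (chi X n)"
  shows "\<not> density1 {z. run {} q z = Some 1}"
proof
  assume "density1 {z. run {} q z = Some 1}"
  then obtain t0 where t0: "\<And>t. t0 \<le> t \<Longrightarrow> \<exists>z. run {} q z = Some 1 \<and> block (index q) t z"
    using eventually_density1_meets_block[of _ "index q"] unfolding eventually_sequentially by blast
  obtain t where t: "t0 \<le> t" "true_stage t" using ex_true_stage by blast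
  obtain z where z: "run {} q z = Some 1" "block (index q) t z" using t0 t(1) by blast
  have "\<forall>\<^sub>F s in sequentially. computed 0 s s (index q) z 1 \<and> t < s"
    using eventually_computed_same[OF z(1)] eventually_gt_at_top by (rule eventually_conj)
  then obtain s where s: "computed 0 s s (index q) z 1" "t < s"
    by (auto simp: eventually_sequentially)
  have "hit (index q) t s" unfolding hit_def using s(1) z(2) computed_le_args(1) by blast
  moreover have "compatible (index p) j t X"
    unfolding compatible_def using guess_true_stage[OF t(2)] X by fastforce
  ultimately have "removed (index p) j (index q) (str_code (initial X t)) s"
    unfolding removed_def using s(2) extends_initial by blast
  moreover have "initial X t \<in> guess_tree (index p) j (index q)"
    using path by (simp add: path_through_def)
  ultimately show False by (simp add: guess_tree_def)
qed

text \<open>Take the least hit whose guess is compatible with \<open>A\<close>. If the tree were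
  dead at that stage, the initial segment of \<open>A\<close> would have been removed earlier,
  through a smaller hit that is also compatible with \<open>A\<close>.\<close>

lemma hit_compatible_if_not_path:
  assumes "\<not> path_through A (guess_tree c j e)"
  obtains r s z where "block e r z" "computed 0 s s e z 1" "compatible c j r A" "\<not> dead c j e r"
proof -
  define good where "good r \<longleftrightarrow> (\<exists>s. hit e r s) \<and> compatible c j r A" for r
  have good: "\<exists>r<s. good r" if "removed c j e (str_code (initial A m)) s" for m s
    using that compatible_if_extends_initial unfolding removed_def good_def by blast
  obtain m s where "removed c j e (str_code (initial A m)) s"
    using assms by (auto simp: path_through_def guess_tree_def)
  then have "\<exists>r. good r" using good by blast
  define r where "r = (LEAST r. good r)"
  have r: "good r" unfolding r_def using \<open>\<exists>r. good r\<close> by (rule LeastI_ex)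
  have "\<not> dead c j e r"
  proof
    assume "dead c j e r"
    moreover have "2 ^ r \<le> Suc (str_code (initial A r))" "Suc (str_code (initial A r)) < 2 ^ Suc r"
      using Suc_str_code_bounds[of "initial A r"] by simp_all
    ultimately obtain s where "s < r" "removed c j e (str_code (initial A r)) s"
      unfolding dead_def by (meson Suc_lessD)
    then obtain r' where "r' < r" "good r'" using good less_trans by blast
    then show False unfolding r_def using not_less_Least by blast
  qed
  then show thesis using r that unfolding good_def hit_def by blast
qed

text \<open>Some level \<open>m\<close> of a finite tree is empty. Its finitely many strings are all
  removed by some stage, and longer strings go with their prefixes.\<close>

lemma eventually_dead:
  assumes "finite (guess_tree c j e)"
  shows "\<forall>\<^sub>F t in sequentially. dead c j e t"
proof -
  obtain m where m: "\<And>\<sigma>. \<sigma> \<in> guess_tree c j e \<Longrightarrow> length \<sigma> < m"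
    using finite_imageI[OF assms, of length] unfolding finite_nat_set_iff_bounded by blast
  have "finite {\<sigma> :: bool list. length \<sigma> = m}"
    using finite_lists_length_eq[of "UNIV :: bool set" m] by simp
  moreover have "\<forall>\<^sub>F t in sequentially. \<exists>s<t. removed c j e (str_code \<sigma>) s"
    if \<sigma>: "\<sigma> \<in> {\<sigma>. length \<sigma> = m}" for \<sigma>
  proof -
    obtain s where "removed c j e (str_code \<sigma>) s"
      using m[of \<sigma>] \<sigma> by (auto simp: guess_tree_def)
    then show ?thesis by (intro eventually_mono[OF eventually_gt_at_top[of s]]) blast
  qed
  ultimately have "\<forall>\<^sub>F t in sequentially.
      \<forall>\<sigma>\<in>{\<sigma>. length \<sigma> = m}. \<exists>s<t. removed c j e (str_code \<sigma>) s"
    by (intro eventually_ball_finite) auto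
  with eventually_ge_at_top[of m] show ?thesis
  proof eventually_elim
    case (elim t)
    show ?case unfolding dead_def
    proof (intro allI impI)
      fix x :: nat assume x: "2 ^ t \<le> Suc x \<and> Suc x < 2 ^ Suc t"
      obtain \<tau> where \<tau>: "str_code \<tau> = x" using surj_str_code by blast
      have "m \<le> length \<tau>"
      proof (cases m)
        case (Suc k)
        have "(2 :: nat) ^ Suc k \<le> 2 ^ t" using elim(1) Suc by (intro power_increasing) auto
        then have "2 ^ Suc k \<le> Suc (str_code \<tau>)" using x \<tau> by linarith
        then show ?thesis using less_length_iff Suc by (simp add: Suc_le_eq del: power_Suc)
      qed simp
      then obtain s where "s < t" "removed c j e (str_code (take m \<tau>)) s"
        using elim(2) by fastforce
      then show "\<exists>s<t. removed c j e x s" using removed_prefix take_is_prefix \<tau> by blast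
    qed
  qed
qed

text \<open>Numbers not divisible by \<open>2 ^ d\<close> lie in the columns below \<open>d\<close>,
  and each of these misses only finitely many finite blocks.\<close>

lemma density1_if_eventually_blocks:
  assumes "\<And>e. \<forall>\<^sub>F t in sequentially. \<forall>z. block e t z \<longrightarrow> z \<in> E"
  shows "density1 E"
proof (rule density1_if_cofinite_off_multiples)
  fix d
  have "\<exists>t0. \<forall>t\<ge>t0. \<forall>z. block e t z \<longrightarrow> z \<in> E" for e
    using assms[of e] unfolding eventually_sequentially .
  then obtain T where T: "\<And>e t z. T e \<le> t \<Longrightarrow> block e t z \<Longrightarrow> z \<in> E" by metis
  have "{z. z \<notin> E \<and> \<not> 2 ^ d dvd z} \<subseteq> (\<Union>e<d. \<Union>t<T e. {z. block e t z})"
  proof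
    fix z assume z: "z \<in> {z. z \<notin> E \<and> \<not> 2 ^ d dvd z}"
    \<comment> \<open>The number 0 lies in no block, but every power of 2 divides it.\<close>
    then have "0 < z" by (cases z) auto
    then obtain e t where et: "block e t z" using ex_block by blast
    have "e < d" using block_column_dvd[OF et, of d] z by (auto simp: not_less[symmetric])
    moreover have "t < T e" using T[of e t z] et z by (auto simp: not_less[symmetric])
    ultimately show "z \<in> (\<Union>e<d. \<Union>t<T e. {z. block e t z})" using et by blast
  qed
  then show "finite {z. z \<notin> E \<and> \<not> 2 ^ d dvd z}"
    by (rule finite_subset) (simp add: finite_block)
qed

lemma density1_UNIV: "density1 UNIV"
  by (rule density1_if_cofinite_off_multiples) simp

theorem mainTheorem3:
  fixes F :: "nat set \<Rightarrow> nat set" and A :: "nat set"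
  assumes "\<And>T. pi01_tree T \<Longrightarrow> infinite T \<Longrightarrow> path_through (F (tree_real T)) T"
    and "\<exists>p. \<forall>T e. pi01_tree T \<longrightarrow> infinite T \<longrightarrow> pi01_index e T \<longrightarrow>
           (\<forall>n. run zero_jump p (prod_encode (e, n)) = Some (chi (F (tree_real T)) n))"
    and "\<not> (\<exists>X \<in> range F. density1 {n. chi X n = chi A n})"
  shows "density1_bounding A"
proof -
  obtain p where p: "\<And>T e n. pi01_tree T \<Longrightarrow> infinite T \<Longrightarrow> pi01_index e T \<Longrightarrow>
      run zero_jump p (pair e n) = Some (chi (F (tree_real T)) n)"
    using assms(2) by blast
  define c where "c = index p"
  obtain i where i: "computable i" "\<And>e. pi01_index (i e) (guess_tree c (i e) e)"
    using ex_tree_indices by blast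
  define T where "T e = guess_tree c (i e) e" for e
  define X where "X e = F (tree_real (T e))" for e
  have tree: "pi01_tree (T e)" for e
    unfolding T_def pi01_tree_def using is_tree_guess_tree i(2) by blast
  have X: "path_through (X e) (T e)" "\<And>n. run zero_jump p (pair (i e) n) = Some (chi (X e) n)"
    if "infinite (T e)" for e
    unfolding X_def using assms(1) p tree that i(2) by (auto simp: T_def)
  have dense: "density1 (enumerated c i P)" if P: "generic_oracle P A" for P
  proof (rule density1_if_eventually_blocks)
    fix e
    show "\<forall>\<^sub>F t in sequentially. \<forall>z. block e t z \<longrightarrow> z \<in> enumerated c i P"
    proof (cases "finite (T e)")
      case True
      then have "\<forall>\<^sub>F t in sequentially. dead c (i e) e t"
        unfolding T_def by (rule eventually_dead)
      then show ?thesis by (rule eventually_mono) (auto simp: enumerated_def)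
    next
      case False
      have "\<not> density1 {n. chi (X e) n = chi A n}" using assms(3) by (auto simp: X_def)
      \<comment> \<open>If the path agreed with \<open>A\<close> on the whole domain of
        \<open>P\<close>, the agreement set would contain a set of density 1.\<close>
      then have "\<not> oracle_dom P \<subseteq> {n. chi (X e) n = chi A n}"
        using P density1_superset unfolding generic_oracle_def by blast
      then obtain n x l where n: "(n, x, l) \<in> P" "chi (X e) n \<noteq> chi A n"
        unfolding oracle_dom_def by blast
      then have "chi (X e) n \<noteq> x"
        using P unfolding generic_oracle_def partial_oracle_def by metis
      then have "z \<in> enumerated c i P"
        if "guess c (i e) t n (chi (X e) n)" "block e t z" for t z
        using that n(1) unfolding enumerated_def by blast
      moreover have "\<forall>\<^sub>F t in sequentially. guess c (i e) t n (chi (X e) n)"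
        unfolding c_def by (rule eventually_guess) (use X(2)[OF False] in simp)
      ultimately show ?thesis by (auto elim: eventually_mono)
    qed
  qed
  \<comment> \<open>The complete oracle for \<open>A\<close>, with all values given at time 0,
    defines the reference set \<open>B\<close>.\<close>
  define P0 where "P0 = {(n, chi A n, 0 :: nat) | n. True}"
  define B where "B = enumerated c i P0"
  have "oracle_dom P0 = UNIV" by (auto simp: oracle_dom_def P0_def)
  then have "generic_oracle P0 A"
    by (auto simp: generic_oracle_def partial_oracle_def P0_def density1_UNIV)
  then have "density1 B" unfolding B_def by (rule dense)
  moreover have "B \<le>\<^sub>g A"
  proof -
    obtain q where q: "\<And>P. run (triples_real P) q
        = (\<lambda>z. if z \<in> enumerated c i P then Some 1 else None)"
      using ex_enumerating_prog[OF i(1)] by blast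
    have "generic_computation (triples_real P) q B" if P: "generic_oracle P A" for P
    proof -
      \<comment> \<open>Recorded values are values of \<open>A\<close>, so a disagreement seen in
        \<open>P\<close> is also seen in \<open>P0\<close>, and no number outside \<open>B\<close>
        is enumerated.\<close>
      have "x = chi A n" if "(n, x, l) \<in> P" for n x l
        using P that by (auto simp: generic_oracle_def partial_oracle_def)
      then have "enumerated c i P \<subseteq> B" unfolding B_def enumerated_def P0_def by fast
      moreover have "dom (run (triples_real P) q) = enumerated c i P"
        by (auto simp: q dom_def)
      ultimately show ?thesis
        unfolding generic_computation_def using dense[OF P] by (auto simp: q chi_def split: if_splits)
    qed
    then show ?thesis unfolding generic_reducible_def by blast
  qed
  moreover have "\<not> generically_computable B"
  proof
    assume "generically_computable B"
    then obtain q where q: "density1 (dom (run {} q))" "\<And>n y. run {} q n = Some y \<Longrightarrow> y = chi B n"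
      unfolding generically_computable_def generic_computation_def by blast
    define e where "e = index q"
    \<comment> \<open>On \<open>B\<close> the generic computation can only return 1, so its 1-set
      has density 1 like \<open>B\<close> and its domain.\<close>
    have "dom (run {} q) \<inter> B \<subseteq> {z. run {} q z = Some 1}"
      using q(2) by (fastforce simp: chi_def)
    then have "density1 {z. run {} q z = Some 1}"
      using density1_superset density1_Int[OF q(1) \<open>density1 B\<close>] by blast
    then have "finite (T e)"
      using not_density1_if_path[of "X e" p "i e" q] X unfolding T_def c_def e_def by blast
    then have "\<not> path_through A (guess_tree c (i e) e)"
      using infinite_if_path unfolding T_def by blast
    then obtain r s z where z: "block e r z" "computed 0 s s e z 1"
      "compatible c (i e) r A" "\<not> dead c (i e) e r"
      by (rule hit_compatible_if_not_path)
    have "run {} q z = Some 1"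
      by (rule run_if_computed[of s 0]) (use z(2) in \<open>simp_all add: e_def\<close>)
    then have "z \<in> B" using q(2)[of z 1] by (auto simp: chi_def split: if_splits)
    then obtain e' t where "block e' t z"
      "dead c (i e') e' t \<or> (\<exists>n x l y. (n, x, l) \<in> P0 \<and> guess c (i e') t n y \<and> y \<noteq> x)"
      unfolding B_def enumerated_def by blast
    \<comment> \<open>Blocks are disjoint, so \<open>z\<close> could enter \<open>B\<close> only
      through column \<open>e\<close> at stage \<open>r\<close>; there the tree is not dead and the
      guess does not contradict \<open>A\<close>.\<close>
    then show False
      using z block_unique[OF z(1), of e' t] unfolding P0_def compatible_def by auto
  qed
  ultimately show ?thesis unfolding density1_bounding_def by blast
qed

end
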